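(* Let $\Phi=(G,\mathbb{T},\varphi)$ be a complex unit gain graph whose underlying graph $G$ is connected. Then $r(G,\varphi)=2m(G)+c(G)$ if and only if all of the following hold: (i) the cycles (if any) of $G$ are pairwise vertex-disjoint; (ii) for each cycle (if any) $C_l=u_1u_2\cdots u_lu_1$ of $G$, $l$ is odd and $\mathrm{Re}(\varphi(C_l))\neq 0$; (iii) $m(T_G)=m(G-O(G))$, where $O(G)$ is the set of vertices lying on cycles of $G$.
   Context: $G=(V,E)$ is a simple graph with $V=\{v_1,\dots,v_n\}$; $e_{i,j}$ denotes the ordered pair $(v_i,v_j)$ for $v_iv_j\in E$, and $\overrightarrow{E}=\{e_{i,j},e_{j,i}: v_iv_j\in E\}$. $\mathbb{T}=\{z\in\mathbb{C}:|z|=1\}$. A complex unit gain graph $(G,\varphi)$ is $G$ together with a map $\varphi:\overrightarrow{E}\to\mathbb{T}$ with $\varphi(e_{i,j})=\varphi(e_{j,i})^{-1}$. Its adjacency matrix is the $n\times n$ Hermitian matrix $H(G,\varphi)=(a_{i,j})$ with $a_{i,j}=\varphi(e_{i,j})$ if $v_iv_j\in E$ and $a_{i,j}=0$ otherwise; $r(G,\varphi)$ is the rank of $H(G,\varphi)$. $m(G)$ is the matching number and $c(G)=|E(G)|-|V(G)|+\omega(G)$ the cyclomatic number ($\omega(G)$ = number of components). For a cycle $C_l=u_1u_2\cdots u_lu_1$, its gain is $\varphi(C_l)=\varphi(u_1u_2)\varphi(u_2u_3)\cdots\varphi(u_lu_1)$, where $\varphi(u_iu_j)$ is the value of $\varphi$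 on the ordered pair $(u_i,u_j)$ (reversing direction gives the conjugate, so $\mathrm{Re}(\varphi(C_l))$ is well defined). $\mathrm{Re}(z)$ is the real part of $z$. $T_G$ is the graph obtained from $G$ by contracting each cycle of $G$ into a single vertex. $G-S$ denotes the subgraph induced by $V\setminus S$. *)

theory Defs
  imports
    "Graph_Theory.Digraph_Component"
    "Graph_Theory.Pair_Digraph"
    "Jordan_Normal_Form.DL_Rank"
    "HOL.Complex"
begin

section \<open>Simple graphs as symmetric digraphs\<close>

text \<open>
  A finite simple graph is a \<open>pair_graph\<close>: a finite, loop-free, symmetric set of arcs
  which are pairs of vertices. The arcs of \<open>G\<close> are thus the ordered pairs
  \<open>(v\<^sub>i, v\<^sub>j)\<close> with \<open>v\<^sub>i v\<^sub>j\<close> an edge; the edges themselves are two-element sets.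
\<close>

definition edges :: "('a, 'b) pre_digraph \<Rightarrow> 'a set set" where
  "edges G = (\<lambda>(u, v). {u, v}) ` arcs_ends G"

definition matching :: "('a, 'b) pre_digraph \<Rightarrow> 'a set set \<Rightarrow> bool" where
  "matching G M \<longleftrightarrow> M \<subseteq> edges G \<and> (\<forall>e \<in> M. \<forall>f \<in> M. e \<noteq> f \<longrightarrow> e \<inter> f = {})"

definition matching_number :: "('a, 'b) pre_digraph \<Rightarrow> nat" where
  "matching_number G = Max (card ` {M. matching G M})"

text \<open>
  For symmetric digraphs, the strongly connected components are the connected components.
\<close>

definition cyclomatic_number :: "('a, 'b) pre_digraph \<Rightarrow> int" where
  "cyclomatic_number G =
     int (card (edges G)) - int (card (verts G)) + int (card (pre_digraph.sccs G))"

text \<open>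
  The digraph notion of a cycle admits the closed walk \<open>u, v, u\<close> along a single edge, which is
  not a cycle of the underlying simple graph; hence the bound on the length. A cycle is given by
  its list of arcs \<open>[(u\<^sub>1, u\<^sub>2), (u\<^sub>2, u\<^sub>3), \<dots>, (u\<^sub>l, u\<^sub>1)]\<close>, so each cycle subgraph of \<open>G\<close> is
  represented by \<open>2 l\<close> lists (starting point and direction), all with the same \<open>cycle_edges\<close>.
\<close>

definition graph_cycle :: "'a pair_pre_digraph \<Rightarrow> ('a \<times> 'a) list \<Rightarrow> bool" where
  "graph_cycle G p \<longleftrightarrow> pre_digraph.cycle (with_proj G) p \<and> 3 \<le> length p"

definition cycle_verts :: "('a \<times> 'a) list \<Rightarrow> 'a set" where
  "cycle_verts p = fst ` set p"

definition cycle_edges :: "('a \<times> 'a) list \<Rightarrow> 'a set set" where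
  "cycle_edges p = (\<lambda>(u, v). {u, v}) ` set p"

definition cycles_vertex_disjoint :: "'a pair_pre_digraph \<Rightarrow> bool" where
  "cycles_vertex_disjoint G \<longleftrightarrow>
     (\<forall>p q. graph_cycle G p \<and> graph_cycle G q \<and> cycle_edges p \<noteq> cycle_edges q
        \<longrightarrow> cycle_verts p \<inter> cycle_verts q = {})"

definition on_cycles :: "'a pair_pre_digraph \<Rightarrow> 'a set" where
  "on_cycles G = (\<Union>p \<in> {p. graph_cycle G p}. cycle_verts p)"

section \<open>Contracting the cycles\<close>

text \<open>
  The vertices of the contracted graph are the classes of vertices of \<open>G\<close> that get identified.
  If the cycles are pairwise vertex-disjoint, these are the vertex sets of the cycles and the
  singletons of the vertices on no cycle. In general, cycles sharing a vertex end up in the same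
  class, which is the reason for the reflexive transitive closure. Loops produced by the
  contraction are dropped and parallel edges are merged.
\<close>

definition same_cycle :: "'a pair_pre_digraph \<Rightarrow> 'a rel" where
  "same_cycle G = {(u, v). \<exists>p. graph_cycle G p \<and> u \<in> cycle_verts p \<and> v \<in> cycle_verts p}"

definition contr_class :: "'a pair_pre_digraph \<Rightarrow> 'a \<Rightarrow> 'a set" where
  "contr_class G u = (same_cycle G)\<^sup>* `` {u}"

definition contract_cycles :: "'a pair_pre_digraph \<Rightarrow> 'a set pair_pre_digraph" where
  "contract_cycles G =
     \<lparr> pverts = contr_class G ` pverts G,
       parcs = {(contr_class G u, contr_class G v) | u v.
                  (u, v) \<in> parcs G \<and> contr_class G u \<noteq> contr_class G v} \<rparr>"

section \<open>Complex unit gain graphs\<close>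

locale complex_unit_gain_graph = pair_graph G
  for G :: "'a pair_pre_digraph" +
  fixes \<phi> :: "'a \<times> 'a \<Rightarrow> complex"
  assumes gain_unit: "e \<in> parcs G \<Longrightarrow> cmod (\<phi> e) = 1"
    and gain_inverse: "(u, v) \<in> parcs G \<Longrightarrow> \<phi> (u, v) = inverse (\<phi> (v, u))"

text \<open>The list \<open>vs\<close> is the enumeration \<open>v\<^sub>1, \<dots>, v\<^sub>n\<close> of the vertices, with indices from \<open>0\<close>.\<close>

definition gain_adj_mat :: "'a list \<Rightarrow> 'a pair_pre_digraph \<Rightarrow> ('a \<times> 'a \<Rightarrow> complex) \<Rightarrow> complex mat"
  where
  "gain_adj_mat vs G \<phi> = mat (length vs) (length vs)
     (\<lambda>(i, j). if (vs ! i, vs ! j) \<in> parcs G then \<phi> (vs ! i, vs ! j) else 0)"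

definition gain_rank :: "'a list \<Rightarrow> 'a pair_pre_digraph \<Rightarrow> ('a \<times> 'a \<Rightarrow> complex) \<Rightarrow> nat" where
  "gain_rank vs G \<phi> = vec_space.rank (length vs) (gain_adj_mat vs G \<phi>)"

definition cycle_gain :: "('a \<times> 'a \<Rightarrow> complex) \<Rightarrow> ('a \<times> 'a) list \<Rightarrow> complex" where
  "cycle_gain \<phi> p = prod_list (map \<phi> p)"

end

theory Submission
  imports Defs
begin

text \<open>
  Let \<open>r\<close> be the rank. Since the adjacency matrix is Hermitian, some principal submatrix on
  \<open>r\<close> vertices is nonsingular, so these vertices admit a permutation along arcs, that is, they
  are partitioned into matching edges and, say, \<open>t\<close> disjoint odd cycles. Matching each odd cycle up
  to one vertex gives \<open>r \<le> 2 m + t\<close>, and \<open>t \<le> c\<close> since an edge of each of the \<open>t\<close> cycles can be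
  deleted without disconnecting the graph. If \<open>r = 2 m + c\<close>, then \<open>t = c\<close>, all cycles of the graph
  are among these \<open>t\<close> cycles, and contracting them leaves a tree; comparing matchings gives (iii).

  Conversely, under (i) and (iii), Koenig's theorem for the contracted tree yields a vertex cover
  \<open>K\<close> of the edges outside the cycles which avoids the cycles and satisfies \<open>2 m + c = 2 |K| + |O|\<close>.
  Away from \<open>K\<close> the matrix is block diagonal, with the cycles as the only nonzero blocks, so
  \<open>r = 2 |K| + |O|\<close> exactly when all cycle blocks are nonsingular. For an odd cycle with gain
  \<open>\<gamma>\<close> this says \<open>\<gamma>\<^sup>2 \<noteq> -1\<close>, i.e. \<open>Re \<gamma> \<noteq> 0\<close>.
\<close>

section \<open>Homogeneous linear systems\<close>

text \<open>The rank, the permutation and the contraction live on different index sets. Therefore no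
  determinant is used: nonsingularity of a principal submatrix becomes \<open>trivial_kernel\<close>
  of a weight function on a set of vertices, and the rank becomes the largest size of such a set.
  Edges are counted as arcs, twice each, so for a connected graph the existence of \<open>c\<close>
  disjoint cycles reads \<open>card R + 2 = 2 * card V + 2 * card \<C>\<close>. This equation,
  assumed in the locale \<open>maximal_disjoint_cycles\<close>, is where both directions meet: one
  derives it from tightness of two inequalities for the rank, the other by deleting one edge per
  cycle. Together with connectedness it shows that the cycles in \<open>\<C>\<close> are chordless,
  that there are no others, and that the contraction is a tree. The real parts in (ii) need no
  separate treatment in the forward direction: once a maximal odd family and (iii) are available,
  the rank equation is equivalent to all real parts being nonzero, and this one equivalence serves
  both directions.\<close>

lemma underdetermined_system_has_nonzero_solution:
  fixes a :: "'i \<Rightarrow> 'j \<Rightarrow> 'c::field"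
  assumes "finite I" "finite J" "card I < card J"
  shows "\<exists>x. (\<exists>j\<in>J. x j \<noteq> 0) \<and> (\<forall>i\<in>I. (\<Sum>j\<in>J. a i j * x j) = 0)"
  using assms
proof (induction I arbitrary: J a rule: finite_induct)
  case empty
  then obtain j where "j \<in> J" by fastforce
  then show ?case by (intro exI[of _ "\<lambda>_. 1"]) auto
next
  case (insert b I)
  show ?case
  proof (cases "\<forall>j\<in>J. a b j = 0")
    case True
    have "card I < card J" using insert by simp
    from insert.IH[OF \<open>finite J\<close> this, of a] show ?thesis using True by auto
  next
    case False
    then obtain k where k: "k \<in> J" "a b k \<noteq> 0" by auto
    \<comment> \<open>Gaussian elimination with pivot \<open>a b k\<close>: this clears column
      \<open>k\<close> from all other rows.\<close>
    define a' where "a' i j = a i j - a i k * a b j / a b k" for i j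
    have "card I < card (J - {k})" using insert k by simp
    from insert.IH[OF _ this, of a'] \<open>finite J\<close> obtain x where
      x: "\<exists>j\<in>J-{k}. x j \<noteq> 0" "\<And>i. i \<in> I \<Longrightarrow> (\<Sum>j\<in>J-{k}. a' i j * x j) = 0" by auto
    define s where "s = (\<Sum>j\<in>J-{k}. a b j * x j)"
    \<comment> \<open>Back substitution: equation \<open>b\<close> dictates the value at the pivot
      column.\<close>
    define y where "y = x(k := - s / a b k)"
    have split: "(\<Sum>j\<in>J. a i j * y j) = - a i k * s / a b k + (\<Sum>j\<in>J-{k}. a i j * x j)" for i
    proof -
      have "(\<Sum>j\<in>J. a i j * y j) = a i k * y k + (\<Sum>j\<in>J-{k}. a i j * y j)"
        using k \<open>finite J\<close> by (simp add: sum.remove)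
      also have "(\<Sum>j\<in>J-{k}. a i j * y j) = (\<Sum>j\<in>J-{k}. a i j * x j)"
        by (rule sum.cong) (auto simp: y_def)
      finally show ?thesis by (simp add: y_def)
    qed
    have "(\<Sum>j\<in>J. a b j * y j) = 0" using k unfolding split s_def[symmetric] by simp
    moreover have "(\<Sum>j\<in>J. a i j * y j) = 0" if "i \<in> I" for i
    proof -
      have "0 = (\<Sum>j\<in>J-{k}. a i j * x j - a i k / a b k * (a b j * x j))"
        unfolding x(2)[OF that, symmetric] a'_def by (intro sum.cong) (auto simp: field_simps)
      also have "\<dots> = (\<Sum>j\<in>J-{k}. a i j * x j) - a i k / a b k * s"
        by (simp add: sum_subtractf sum_distrib_left s_def)
      finally show ?thesis unfolding split by (simp add: algebra_simps)
    qed
    moreover have "\<exists>j\<in>J. y j \<noteq> 0" using x(1) by (auto simp: y_def)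
    ultimately show ?thesis by (intro exI[of _ y]) auto
  qed
qed

text \<open>For \<open>card I = card J\<close> this is nonsingularity of the submatrix with rows
  \<open>I\<close> and columns \<open>J\<close>. Values of \<open>x\<close> outside \<open>J\<close>
  are irrelevant, so no enumeration of the index sets is involved.\<close>

definition trivial_kernel :: "('i \<Rightarrow> 'j \<Rightarrow> 'c::field) \<Rightarrow> 'i set \<Rightarrow> 'j set \<Rightarrow> bool" where
  "trivial_kernel a I J \<longleftrightarrow> (\<forall>x. (\<forall>i\<in>I. (\<Sum>j\<in>J. a i j * x j) = 0) \<longrightarrow> (\<forall>j\<in>J. x j = 0))"

lemma trivial_kernelD:
  assumes "trivial_kernel a I J" "\<And>i. i \<in> I \<Longrightarrow> (\<Sum>j\<in>J. a i j * x j) = 0" "j \<in> J"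
  shows "x j = 0"
  using assms unfolding trivial_kernel_def by blast

text \<open>
  A term of the Leibniz expansion is found without determinants: the kernel of all rows but \<open>i\<close>
  is spanned by one vector \<open>z\<close>, and deleting row \<open>i\<close> and a column \<open>j\<close> with \<open>a i j * z j \<noteq> 0\<close>
  leaves a system with trivial kernel.
\<close>

lemma trivial_kernel_imp_transversal:
  fixes a :: "'i \<Rightarrow> 'j \<Rightarrow> 'c::field"
  assumes "finite I" "finite J" "card I = card J" "trivial_kernel a I J"
  shows "\<exists>f. bij_betw f I J \<and> (\<forall>i\<in>I. a i (f i) \<noteq> 0)"
  using assms
proof (induction I arbitrary: J rule: finite_induct)
  case empty
  then show ?case by (auto simp: bij_betw_def)
next
  case (insert b I)
  have "card I < card J" using insert by simp
  from underdetermined_system_has_nonzero_solution[OF \<open>finite I\<close> \<open>finite J\<close> this, of a]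
  obtain z where z: "\<exists>j\<in>J. z j \<noteq> 0" "\<And>i. i \<in> I \<Longrightarrow> (\<Sum>j\<in>J. a i j * z j) = 0"
    by blast
  define s where "s = (\<Sum>j\<in>J. a b j * z j)"
  have "s \<noteq> 0"
  proof
    assume "s = 0"
    then have "(\<Sum>j\<in>J. a i j * z j) = 0" if "i \<in> insert b I" for i
      using z(2) that by (auto simp: s_def)
    from trivial_kernelD[OF insert.prems(3) this] z(1) show False by blast
  qed
  then obtain k where k: "k \<in> J" "a b k \<noteq> 0" "z k \<noteq> 0"
    unfolding s_def by (metis (mono_tags, lifting) mult_not_zero sum.neutral)
  have "trivial_kernel a I (J - {k})"
    unfolding trivial_kernel_def
  proof (intro allI impI)
    fix x assume x: "\<forall>i\<in>I. (\<Sum>j\<in>J-{k}. a i j * x j) = 0"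
    define y where "y = x(k := 0)"
    have y: "(\<Sum>j\<in>J. a i j * y j) = (\<Sum>j\<in>J-{k}. a i j * x j)" for i
      by (rule sum.mono_neutral_cong_right) (use insert.prems in \<open>auto simp: y_def\<close>)
    define t where "t = (\<Sum>j\<in>J. a b j * y j)"
    \<comment> \<open>The weights \<open>s\<close> and \<open>t\<close> are the values of row
      \<open>b\<close> on \<open>z\<close> and \<open>y\<close>, crossed so that row
      \<open>b\<close> also kills the combination. At \<open>k\<close> only \<open>- z k * t\<close>
      survives, which forces \<open>t = 0\<close>.\<close>
    have "(\<Sum>j\<in>J. a i j * (y j * s - z j * t)) = (\<Sum>j\<in>J. a i j * y j) * s - (\<Sum>j\<in>J. a i j * z j) * t"
      for i unfolding sum_distrib_right sum_subtractf[symmetric] by (simp add: algebra_simps)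
    then have "(\<Sum>j\<in>J. a i j * (y j * s - z j * t)) = 0" if "i \<in> insert b I" for i
      using that x z(2) y by (auto simp: s_def t_def)
    note 1 = trivial_kernelD[OF insert.prems(3) this]
    from 1[of k] k have "t = 0" by (simp add: y_def)
    then have "y j = 0" if "j \<in> J" for j using 1[OF _ that] \<open>s \<noteq> 0\<close> by simp
    moreover have "y j = x j" if "j \<in> J - {k}" for j using that by (simp add: y_def)
    ultimately show "\<forall>j\<in>J-{k}. x j = 0" by fastforce
  qed
  moreover have "card I = card (J - {k})" using insert k by simp
  ultimately obtain f where f: "bij_betw f I (J - {k})" "\<forall>i\<in>I. a i (f i) \<noteq> 0"
    using insert.IH[of "J - {k}"] insert.prems by auto
  define g where "g = f(b := k)"
  have "bij_betw g I (J - {k})"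
    using f(1) insert.hyps(2) by (subst bij_betw_cong[of I g f]) (auto simp: g_def)
  then have "bij_betw g (I \<union> {b}) ((J - {k}) \<union> {k})"
    by (rule bij_betw_combine) (auto simp: g_def bij_betw_def)
  moreover have "J - {k} \<union> {k} = J" "I \<union> {b} = insert b I" using k by auto
  ultimately have "bij_betw g (insert b I) J" by simp
  moreover have "\<forall>i\<in>insert b I. a i (g i) \<noteq> 0" using f(2) k by (auto simp: g_def)
  ultimately show ?case by blast
qed

section \<open>Principal submatrices and the rank of a Hermitian matrix\<close>

text \<open>A linear dependence among the columns indexed by \<open>S\<close>, read off in the rows
  of \<open>S\<close> only, would be a nonzero kernel vector.\<close>

lemma (in vec_space) rank_ge_trivial_kernel:
  assumes A: "A \<in> carrier_mat n n" and S: "S \<subseteq> {..<n}"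
    and tk: "trivial_kernel (\<lambda>i j. A $$ (i, j)) S S"
  shows "card S \<le> rank A"
proof -
  have fin: "finite S" using S finite_subset by blast
  \<comment> \<open>Rank is measured by sets of columns, where equal columns would collapse. They
    are excluded by the kernel vector with entries 1 and -1.\<close>
  have inj: "inj_on (col A) S"
  proof (rule inj_onI, rule ccontr)
    fix i j assume ij: "i \<in> S" "j \<in> S" "col A i = col A j" "i \<noteq> j"
    define x where "x = (\<lambda>k. if k = i then 1 else if k = j then - 1 else (0::'a))"
    have "(\<Sum>l\<in>S. A $$ (k, l) * x l) = 0" if "k \<in> S" for k
    proof -
      have "(\<Sum>l\<in>S. A $$ (k, l) * x l) = (\<Sum>l\<in>{i, j}. A $$ (k, l) * x l)"
        by (rule sum.mono_neutral_right) (use fin ij in \<open>auto simp: x_def\<close>)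
      also have "\<dots> = A $$ (k, i) - A $$ (k, j)" using ij by (simp add: x_def)
      also have "\<dots> = col A i $ k - col A j $ k"
        using A S ij that by (subst (1 2) index_col) auto
      finally show ?thesis using ij by simp
    qed
    from trivial_kernelD[OF tk this \<open>i \<in> S\<close>] show False by (simp add: x_def)
  qed
  have sub: "col A ` S \<subseteq> set (cols A)" using A S by (auto simp: cols_def)
  have "lin_indpt (col A ` S)"
  proof
    assume "lin_dep (col A ` S)"
    moreover have "col A ` S \<subseteq> carrier_vec n" using A by auto
    ultimately obtain a v where
      av: "lincomb a (col A ` S) = 0\<^sub>v n" "v \<in> col A ` S" "a v \<noteq> 0"
      using finite_lin_dep[of "col A ` S"] fin by (metis finite_imageI)
    have "(\<Sum>j\<in>S. A $$ (i, j) * a (col A j)) = 0" if "i \<in> S" for i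
    proof -
      have "0 = lincomb a (col A ` S) $ i" using av that S by auto
      also have "\<dots> = (\<Sum>v\<in>col A ` S. a v * v $ i)"
        by (rule lincomb_index) (use A S that in auto)
      also have "\<dots> = (\<Sum>j\<in>S. a (col A j) * col A j $ i)"
        by (simp add: sum.reindex[OF inj])
      also have "\<dots> = (\<Sum>j\<in>S. A $$ (i, j) * a (col A j))"
      proof (rule sum.cong[OF refl])
        fix j assume "j \<in> S"
        then show "a (col A j) * col A j $ i = A $$ (i, j) * a (col A j)"
          using A S that by (subst index_col) auto
      qed
      finally show ?thesis by simp
    qed
    from trivial_kernelD[OF tk this] av show False by auto
  qed
  from rank_ge_card_indpt[OF A sub this] show ?thesis by (simp add: card_image[OF inj])
qed

text \<open>Take a maximal independent set of columns. By Hermitian symmetry the rows with the same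
  indices span all rows, so a vector killed by these rows is killed by every row and is a linear
  relation among independent columns.\<close>

lemma rank_attained_by_principal_submatrix:
  fixes A :: "complex mat"
  assumes A: "A \<in> carrier_mat n n" and herm: "\<And>i j. i < n \<Longrightarrow> j < n \<Longrightarrow> A $$ (i, j) = cnj (A $$ (j, i))"
  shows "\<exists>S\<subseteq>{..<n}. card S = vec_space.rank n A \<and> trivial_kernel (\<lambda>i j. A $$ (i, j)) S S"
proof -
  interpret vec_space "TYPE(complex)" n .
  have car: "set (cols A) \<subseteq> carrier_vec n" using A cols_dim by blast
  obtain U where U: "maximal U (\<lambda>T. T \<subseteq> set (cols A) \<and> lin_indpt T)" "finite U"
  proof -
    have "lin_indpt {}" by (auto simp: lin_dep_def)
    then show thesis
      using maximal_exists_superset[of "set (cols A)" "\<lambda>T. T \<subseteq> set (cols A) \<and> lin_indpt T" "{}"] that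
      by blast
  qed
  have Usub: "U \<subseteq> set (cols A)" and li: "lin_indpt U" using U by (auto simp: maximal_def)
  have Ucar: "U \<subseteq> carrier_vec n" using Usub car by blast
  have "\<forall>u\<in>U. \<exists>i<n. col A i = u"
    using Usub A by (fastforce simp: cols_def)
  then obtain idx where idx: "\<And>u. u \<in> U \<Longrightarrow> idx u < n" "\<And>u. u \<in> U \<Longrightarrow> col A (idx u) = u" by metis
  have ent: "u $ k = A $$ (k, idx u)" if "u \<in> U" "k < n" for u k
    using idx[OF that(1)] A that(2) index_col[of k A "idx u"] by simp
  have inj: "inj_on idx U" by (metis idx(2) inj_onI)
  have spanned: "\<exists>c. \<forall>k<n. A $$ (k, j) = (\<Sum>u\<in>U. c u * A $$ (k, idx u))" if j: "j < n" for j
  proof -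
    have c: "col A j \<in> set (cols A)" using j A by (auto simp: cols_def)
    have "col A j \<in> span U"
    proof (rule ccontr)
      assume no: "col A j \<notin> span U"
      then have "col A j \<notin> U" using in_own_span[OF Ucar] by blast
      moreover have "lin_indpt (insert (col A j) U)"
        using lin_dep_iff_in_span[OF Ucar li _ \<open>col A j \<notin> U\<close>] no c car by auto
      ultimately show False using U(1) c Usub unfolding maximal_def by blast
    qed
    from finite_in_span[OF U(2) Ucar this] obtain c where c: "lincomb c U = col A j"
      by blast
    have "A $$ (k, j) = (\<Sum>u\<in>U. c u * A $$ (k, idx u))" if "k < n" for k
    proof -
      have "A $$ (k, j) = lincomb c U $ k" using c A j that by simp
      also have "\<dots> = (\<Sum>u\<in>U. c u * u $ k)" by (rule lincomb_index) (use that Ucar in auto)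
      also have "\<dots> = (\<Sum>u\<in>U. c u * A $$ (k, idx u))"
        by (rule sum.cong[OF refl]) (simp add: ent that)
      finally show ?thesis .
    qed
    then show ?thesis by blast
  qed
  have "trivial_kernel (\<lambda>i j. A $$ (i, j)) (idx ` U) (idx ` U)"
    unfolding trivial_kernel_def
  proof (intro allI impI)
    fix x assume x: "\<forall>i\<in>idx ` U. (\<Sum>j\<in>idx ` U. A $$ (i, j) * x j) = 0"
    have all: "(\<Sum>j\<in>idx ` U. A $$ (i, j) * x j) = 0" if i: "i < n" for i
    proof -
      from spanned[OF i] obtain c where c: "\<And>k. k < n \<Longrightarrow> A $$ (k, i) = (\<Sum>u\<in>U. c u * A $$ (k, idx u))"
        by blast
      have row: "A $$ (i, k) = (\<Sum>u\<in>U. cnj (c u) * A $$ (idx u, k))" if "k < n" for k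
      proof -
        have "A $$ (i, k) = cnj (\<Sum>u\<in>U. c u * A $$ (k, idx u))" using herm[OF i that] c[OF that] by simp
        also have "\<dots> = (\<Sum>u\<in>U. cnj (c u) * cnj (A $$ (k, idx u)))" by simp
        also have "\<dots> = (\<Sum>u\<in>U. cnj (c u) * A $$ (idx u, k))"
          by (rule sum.cong[OF refl]) (simp only: herm[OF idx(1) that])
        finally show ?thesis .
      qed
      have "(\<Sum>j\<in>idx ` U. A $$ (i, j) * x j)
          = (\<Sum>j\<in>idx ` U. \<Sum>u\<in>U. cnj (c u) * (A $$ (idx u, j) * x j))"
        by (rule sum.cong[OF refl]) (clarsimp simp: row idx sum_distrib_right mult.assoc)
      also have "\<dots> = (\<Sum>u\<in>U. cnj (c u) * (\<Sum>j\<in>idx ` U. A $$ (idx u, j) * x j))"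
        by (subst sum.swap) (simp add: sum_distrib_left)
      also have "\<dots> = 0" using x by simp
      finally show ?thesis .
    qed
    have "lincomb (\<lambda>u. x (idx u)) U = 0\<^sub>v n"
    proof (rule eq_vecI)
      show "dim_vec (lincomb (\<lambda>u. x (idx u)) U) = dim_vec (0\<^sub>v n :: complex vec)"
        using lincomb_dim[OF U(2) Ucar] by simp
      fix i assume "i < dim_vec (0\<^sub>v n :: complex vec)"
      then have i: "i < n" by simp
      have "lincomb (\<lambda>u. x (idx u)) U $ i = (\<Sum>u\<in>U. x (idx u) * u $ i)"
        by (rule lincomb_index[OF i Ucar])
      also have "\<dots> = (\<Sum>u\<in>U. A $$ (i, idx u) * x (idx u))"
        by (rule sum.cong[OF refl]) (simp add: ent i)
      also have "\<dots> = 0" using all[OF i] by (simp add: sum.reindex[OF inj])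
      finally show "lincomb (\<lambda>u. x (idx u)) U $ i = 0\<^sub>v n $ i" using i by simp
    qed
    then have "x (idx u) = 0" if "u \<in> U" for u
      using lin_dep_crit[OF U(2) subset_refl _ that _ \<open>_ = 0\<^sub>v n\<close>] li by blast
    then show "\<forall>j\<in>idx ` U. x j = 0" by simp
  qed
  moreover have "card (idx ` U) = rank A"
    using rank_card_indpt[OF A U(1)] card_image[OF inj] by simp
  moreover have "idx ` U \<subseteq> {..<n}" using idx(1) by blast
  ultimately show ?thesis by blast
qed

section \<open>Symmetric relations and their cycles\<close>

text \<open>\<open>zip us (rotate1 us)\<close> is the arc list by which \<open>graph_cycle\<close>
  represents a cycle; the pairing with \<open>rotate1\<close> includes the closing arc.\<close>

definition cyclic_arcs :: "'a list \<Rightarrow> 'a rel" where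
  "cyclic_arcs us = set (zip us (rotate1 us))"

definition cyclic_edges :: "'a list \<Rightarrow> 'a set set" where
  "cyclic_edges us = (\<lambda>(u, v). {u, v}) ` cyclic_arcs us"

definition rel_cycle :: "'a rel \<Rightarrow> 'a list \<Rightarrow> bool" where
  "rel_cycle R us \<longleftrightarrow> 3 \<le> length us \<and> distinct us \<and> cyclic_arcs us \<subseteq> R"

lemma cyclic_arcs_conv_nth:
  "cyclic_arcs us = {(us ! i, us ! (Suc i mod length us)) |i. i < length us}"
  unfolding cyclic_arcs_def set_zip by (auto simp: nth_rotate1)

lemma cyclic_arcs_rotate [simp]: "cyclic_arcs (rotate n us) = cyclic_arcs us"
proof (induction n)
  case (Suc n)
  have "cyclic_arcs (rotate1 vs) = cyclic_arcs vs" for vs :: "'a list"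
  proof -
    have "zip (rotate1 vs) (rotate1 (rotate1 vs)) = rotate1 (zip vs (rotate1 vs))"
    proof (rule nth_equalityI)
      fix i assume "i < length (zip (rotate1 vs) (rotate1 (rotate1 vs)))"
      then have i: "i < length vs" by simp
      then have j: "Suc i mod length vs < length vs" by (intro mod_less_divisor) auto
      show "zip (rotate1 vs) (rotate1 (rotate1 vs)) ! i = rotate1 (zip vs (rotate1 vs)) ! i"
        using i j by (simp add: nth_rotate1)
    qed simp
    then show ?thesis by (simp add: cyclic_arcs_def)
  qed
  then show ?case using Suc by simp
qed simp

lemma rel_cycle_rotate [simp]: "rel_cycle R (rotate n us) = rel_cycle R us"
  by (simp add: rel_cycle_def)

lemma fst_cyclic_arcs [simp]: "fst ` cyclic_arcs us = set us"
  unfolding cyclic_arcs_def by (metis length_rotate1 map_fst_zip set_map)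

lemma snd_cyclic_arcs [simp]: "snd ` cyclic_arcs us = set us"
  unfolding cyclic_arcs_def by (metis length_rotate1 map_snd_zip set_map set_rotate1)

lemma cyclic_arcs_in_set:
  assumes "(a, b) \<in> cyclic_arcs us" shows "a \<in> set us" "b \<in> set us"
proof -
  show "a \<in> set us" using imageI[OF assms, of fst] by simp
  show "b \<in> set us" using imageI[OF assms, of snd] by simp
qed

lemma Union_cyclic_edges [simp]: "\<Union>(cyclic_edges us) = set us"
proof
  show "\<Union>(cyclic_edges us) \<subseteq> set us"
    by (auto simp: cyclic_edges_def dest: cyclic_arcs_in_set)
  have "u \<in> \<Union>(cyclic_edges us)" if "u \<in> fst ` cyclic_arcs us" for u
    using that by (force simp: cyclic_edges_def)
  then show "set us \<subseteq> \<Union>(cyclic_edges us)" by auto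
qed

lemma finite_cyclic_arcs [simp]: "finite (cyclic_arcs us)"
  by (simp add: cyclic_arcs_def)

lemma card_cyclic_arcs: "distinct us \<Longrightarrow> card (cyclic_arcs us) = length us"
  unfolding cyclic_arcs_def by (subst distinct_card) (auto intro: distinct_zipI1)

lemma cyclic_arcs_unique:
  assumes "distinct us" "(a, b) \<in> cyclic_arcs us" "(a, c) \<in> cyclic_arcs us"
  shows "b = c"
  using assms unfolding cyclic_arcs_conv_nth by (auto simp: nth_eq_iff_index_eq)

text \<open>Rotation turns any chosen arc into the closing one; the rest of the cycle is then a
  plain path from \<open>b\<close> to \<open>a\<close>.\<close>

lemma rel_cycle_arc_last_hd:
  assumes "rel_cycle R us" "(a, b) \<in> cyclic_arcs us"
  obtains vs where "rel_cycle R vs" "cyclic_arcs vs = cyclic_arcs us"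
    "hd vs = b" "last vs = a" "length vs = length us"
proof -
  from assms obtain i where i: "i < length us" "a = us ! i" "b = us ! (Suc i mod length us)"
    by (auto simp: cyclic_arcs_conv_nth)
  let ?vs = "rotate (Suc i) us"
  have l: "3 \<le> length us" using assms by (simp add: rel_cycle_def)
  have ne: "us \<noteq> []" using l by auto
  have "hd ?vs = b" using hd_rotate_conv_nth[OF ne, of "Suc i"] i by simp
  moreover have "last ?vs = a"
  proof -
    have "last ?vs = ?vs ! (length us - 1)" using ne by (simp add: last_conv_nth del: rotate_Suc)
    also have "\<dots> = us ! ((Suc i + (length us - 1)) mod length us)"
      using l by (subst nth_rotate) auto
    also have "(Suc i + (length us - 1)) mod length us = i"
    proof -
      have "Suc i + (length us - 1) = i + length us" using l by simp
      then show ?thesis using i by simp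
    qed
    finally show ?thesis using i by simp
  qed
  ultimately show thesis
    using that[of ?vs] assms(1) rel_cycle_rotate[of R "Suc i" us] cyclic_arcs_rotate[of "Suc i" us]
    by (simp del: rotate_Suc)
qed

text \<open>Here the length bound 3 matters: with \<open>b\<close> first and \<open>a\<close> last,
  the successor of \<open>b\<close> is the second vertex, which is not the last one.\<close>

lemma rel_cycle_arc_reverse_notin:
  assumes "rel_cycle R us" "(a, b) \<in> cyclic_arcs us"
  shows "(b, a) \<notin> cyclic_arcs us"
proof
  assume ba: "(b, a) \<in> cyclic_arcs us"
  obtain vs where vs: "rel_cycle R vs" "cyclic_arcs vs = cyclic_arcs us" "hd vs = b" "last vs = a"
    using rel_cycle_arc_last_hd[OF assms] by metis
  have l: "3 \<le> length vs" "distinct vs" using vs by (auto simp: rel_cycle_def)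
  from l(1) have "vs \<noteq> []" by auto
  then have h: "b = vs ! 0" "a = vs ! (length vs - 1)"
    using vs(3,4) by (simp_all add: hd_conv_nth last_conv_nth)
  have "(vs ! 0, vs ! 1) \<in> cyclic_arcs vs" unfolding cyclic_arcs_conv_nth using l by force
  with ba vs h have "vs ! 1 = vs ! (length vs - 1)"
    using cyclic_arcs_unique[OF l(2)] by metis
  moreover have "vs ! 1 \<noteq> vs ! (length vs - 1)" using l by (subst nth_eq_iff_index_eq) auto
  ultimately show False by simp
qed

section \<open>Connectedness and the cyclomatic bound\<close>

definition connected_rel :: "'a set \<Rightarrow> 'a rel \<Rightarrow> bool" where
  "connected_rel V R \<longleftrightarrow> (\<forall>u\<in>V. \<forall>v\<in>V. (u, v) \<in> R\<^sup>*)"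

text \<open>Inequality is that of lists, so a family contains at most one of the rotations and
  reversals of a given cycle.\<close>

definition disjoint_cycles :: "'a rel \<Rightarrow> 'a list set \<Rightarrow> bool" where
  "disjoint_cycles R \<C> \<longleftrightarrow> finite \<C> \<and> (\<forall>C\<in>\<C>. rel_cycle R C)
     \<and> (\<forall>C\<in>\<C>. \<forall>D\<in>\<C>. C \<noteq> D \<longrightarrow> set C \<inter> set D = {})"

locale finite_symmetric_relation =
  fixes V :: "'a set" and R :: "'a rel"
  assumes finite_verts [simp]: "finite V"
    and rel_subset: "R \<subseteq> V \<times> V"
    and rel_sym: "(u, v) \<in> R \<Longrightarrow> (v, u) \<in> R"
    and rel_irrefl: "(u, u) \<notin> R"
begin

lemma finite_rel [simp]: "finite R"
  using rel_subset finite_subset by fastforce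

lemma rel_in_verts: "(u, v) \<in> R \<Longrightarrow> u \<in> V" "(u, v) \<in> R \<Longrightarrow> v \<in> V"
  using rel_subset by auto

lemma rel_cycle_subset_verts: "rel_cycle R us \<Longrightarrow> set us \<subseteq> V"
  using image_mono[of "cyclic_arcs us" R fst] rel_in_verts by (auto simp: rel_cycle_def)

lemma remove_edge: "finite_symmetric_relation V (R - {(a, b), (b, a)})"
  using rel_subset rel_sym rel_irrefl by unfold_locales auto

lemma card_remove_edge:
  assumes "(a, b) \<in> R" shows "card (R - {(a, b), (b, a)}) + 2 = card R"
proof -
  have "a \<noteq> b" "(b, a) \<in> R" using assms rel_sym rel_irrefl by auto
  then have "card {(a, b), (b, a)} = 2" "{(a, b), (b, a)} \<subseteq> R" using assms by auto
  then show ?thesis using card_Diff_subset[of "{(a, b), (b, a)}" R]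
      card_mono[OF finite_rel, of "{(a, b), (b, a)}"] by simp
qed

lemma rel_crossing:
  assumes "(u, v) \<in> R\<^sup>*" "u \<in> A" "v \<notin> A"
  obtains a b where "(a, b) \<in> R" "a \<in> A" "b \<notin> A"
  using assms by (induction rule: rtrancl_induct) auto

text \<open>Starting from \<open>A\<close>, vertices are absorbed along crossing arcs, and each
  brings at least two new arcs. A singleton \<open>A\<close> gives the spanning tree bound; general
  \<open>A\<close> is what \<open>tree_degenerate\<close> uses.\<close>

lemma connected_card_rel:
  assumes "connected_rel V R" "A \<subseteq> V" "A \<noteq> {}"
  shows "card (R \<inter> A \<times> A) + 2 * card (V - A) \<le> card R"
  using assms(2,3)
proof (induction "card (V - A)" arbitrary: A)
  case 0
  then show ?case by (auto intro: card_mono)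
next
  case (Suc n)
  from Suc.prems obtain u where u: "u \<in> A" by auto
  from Suc.hyps(2) have "V - A \<noteq> {}" by force
  then obtain v where v: "v \<in> V" "v \<notin> A" by auto
  have "(u, v) \<in> R\<^sup>*" using u v assms(1) Suc.prems by (auto simp: connected_rel_def)
  then obtain a b where ab: "(a, b) \<in> R" "a \<in> A" "b \<notin> A"
    using rel_crossing u v by blast
  let ?A = "insert b A"
  have b: "b \<in> V" using ab rel_in_verts by blast
  have c: "card (V - A) = Suc (card (V - ?A))"
    using card_Suc_Diff1[of "V - A" b] b ab by (simp add: Diff_insert[symmetric])
  have "card (R \<inter> ?A \<times> ?A) + 2 * card (V - ?A) \<le> card R"
    by (rule Suc.hyps(1)) (use c Suc.hyps(2) Suc.prems b in auto)
  moreover have "card (R \<inter> A \<times> A \<union> {(a, b), (b, a)}) = card (R \<inter> A \<times> A) + 2"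
  proof -
    have "a \<noteq> b" using ab by blast
    then have "card {(a, b), (b, a)} = 2" by auto
    then show ?thesis using ab by (subst card_Un_disjoint) auto
  qed
  moreover have "R \<inter> A \<times> A \<union> {(a, b), (b, a)} \<subseteq> R \<inter> ?A \<times> ?A"
    using ab rel_sym by auto
  then have "card (R \<inter> A \<times> A \<union> {(a, b), (b, a)}) \<le> card (R \<inter> ?A \<times> ?A)"
    by (intro card_mono) auto
  ultimately show ?case using c by simp
qed

lemma connected_card_rel_ge:
  assumes "connected_rel V R" "V \<noteq> {}"
  shows "2 * card V \<le> card R + 2"
proof -
  from assms obtain v where v: "v \<in> V" by auto
  have "card V = Suc (card (V - {v}))" using v by (simp only: card_Suc_Diff1 finite_verts)
  then show ?thesis using connected_card_rel[OF assms(1), of "{v}"] v by simp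
qed

lemma connected_remove_cycle_edge:
  assumes "connected_rel V R" "rel_cycle R us" "(a, b) \<in> cyclic_arcs us"
  shows "connected_rel V (R - {(a, b), (b, a)})" (is "connected_rel V ?R")
proof -
  interpret R': finite_symmetric_relation V ?R by (rule remove_edge)
  obtain vs where vs: "rel_cycle R vs" "hd vs = b" "last vs = a"
    using rel_cycle_arc_last_hd[OF assms(2,3)] by metis
  have l: "3 \<le> length vs" "distinct vs" using vs by (auto simp: rel_cycle_def)
  from l(1) have "vs \<noteq> []" by auto
  then have h: "b = vs ! 0" "a = vs ! (length vs - 1)"
    using vs(2,3) by (simp_all add: hd_conv_nth last_conv_nth)
  have arc: "(vs ! j, vs ! Suc j) \<in> ?R" if j: "Suc j < length vs" for j
  proof -
    have "(vs ! j, vs ! Suc j) \<in> cyclic_arcs vs" unfolding cyclic_arcs_conv_nth using j by force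
    then have "(vs ! j, vs ! Suc j) \<in> R" using vs(1) by (auto simp: rel_cycle_def)
    moreover have "vs ! j \<noteq> a" using l j unfolding h by (subst nth_eq_iff_index_eq) auto
    moreover have "vs ! j \<noteq> b \<or> vs ! Suc j \<noteq> a"
      using l j unfolding h by (subst (1 2) nth_eq_iff_index_eq) auto
    ultimately show ?thesis by auto
  qed
  have path: "(b, vs ! j) \<in> ?R\<^sup>*" if "j < length vs" for j
    using that
  proof (induction j)
    case (Suc j)
    then show ?case using arc[of j] by (meson Suc_lessD rtrancl.rtrancl_into_rtrancl)
  qed (simp add: h)
  then have ba: "(b, a) \<in> ?R\<^sup>*" using path[of "length vs - 1"] l h(2) by simp
  have "sym (?R\<^sup>*)" by (rule sym_rtrancl) (use R'.rel_sym in \<open>auto simp: sym_def\<close>)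
  then have "(a, b) \<in> ?R\<^sup>*" using ba by (rule symD)
  then have "R \<subseteq> ?R\<^sup>*" using ba by auto
  then have "R\<^sup>* \<subseteq> ?R\<^sup>*" using rtrancl_subset_rtrancl by blast
  then show ?thesis using assms(1) by (auto simp: connected_rel_def)
qed

end

text \<open>The factors 2 come from counting arcs. Deleting an edge of \<open>C\<close> leaves the
  other cycles intact because they avoid its endpoint \<open>a\<close>.\<close>

lemma (in finite_symmetric_relation) disjoint_cycles_le_cyclomatic:
  assumes "connected_rel V R" "V \<noteq> {}" "disjoint_cycles R \<C>"
  shows "2 * card V + 2 * card \<C> \<le> card R + 2"
proof -
  have "finite \<C>" using assms by (simp add: disjoint_cycles_def)
  then show ?thesis using assms finite_symmetric_relation_axioms
  proof (induction \<C> arbitrary: R rule: finite_induct)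
    case (empty R)
    then interpret finite_symmetric_relation V R by simp
    show ?case using connected_card_rel_ge empty by simp
  next
    case (insert C \<C> R)
    then interpret finite_symmetric_relation V R by simp
    have C: "rel_cycle R C" using insert.prems by (simp add: disjoint_cycles_def)
    then have "cyclic_arcs C \<noteq> {}" using card_cyclic_arcs[of C] by (auto simp: rel_cycle_def)
    then obtain a b where ab: "(a, b) \<in> cyclic_arcs C" by auto
    let ?R = "R - {(a, b), (b, a)}"
    have "disjoint_cycles ?R \<C>"
      unfolding disjoint_cycles_def
    proof (intro conjI ballI)
      fix D assume D: "D \<in> \<C>"
      then have "C \<noteq> D" using insert.hyps(2) by blast
      then have "set C \<inter> set D = {}" "rel_cycle R D"
        using insert.prems(3) D by (auto simp: disjoint_cycles_def)
      then have "a \<notin> set D" "rel_cycle R D" using cyclic_arcs_in_set(1)[OF ab] by auto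
      then show "rel_cycle ?R D" by (auto simp: rel_cycle_def dest: cyclic_arcs_in_set)
    qed (use insert.prems(3) in \<open>auto simp: disjoint_cycles_def\<close>)
    then have "2 * card V + 2 * card \<C> \<le> card ?R + 2"
      using insert.IH connected_remove_cycle_edge[OF insert.prems(1) C ab] insert.prems(2)
        remove_edge by blast
    moreover have "(a, b) \<in> R" using ab C by (auto simp: rel_cycle_def)
    ultimately show ?case using card_remove_edge[of a b] insert.hyps by simp
  qed
qed

text \<open>
  If a further cycle existed, an edge could be deleted without disconnecting the graph and
  without lowering the number of disjoint cycles.
\<close>

lemma (in finite_symmetric_relation) disjoint_cycles_exhaust:
  assumes conn: "connected_rel V R" and ne: "V \<noteq> {}" and disj: "disjoint_cycles R \<C>"
    and card: "card R + 2 = 2 * card V + 2 * card \<C>" and us: "rel_cycle R us"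
  shows "\<exists>C\<in>\<C>. cyclic_edges us = cyclic_edges C"
proof -
  \<comment> \<open>Losing an edge of a cycle keeps the graph connected but lowers
    \<open>card R\<close> by 2, which leaves room for only \<open>card \<C> - 1\<close> disjoint
    cycles.\<close>
  have contra: False if "rel_cycle R vs" "(a, b) \<in> cyclic_arcs vs"
    "disjoint_cycles (R - {(a, b), (b, a)}) \<D>" "card \<D> = card \<C>" for a b vs \<D>
  proof -
    interpret R': finite_symmetric_relation V "R - {(a, b), (b, a)}" by (rule remove_edge)
    have "(a, b) \<in> R" using that(1,2) unfolding rel_cycle_def by blast
    then show False
      using R'.disjoint_cycles_le_cyclomatic[OF connected_remove_cycle_edge[OF conn that(1,2)] ne that(3)]
        card_remove_edge[of a b] that(4) card by simp
  qed
  have still_cycle: "rel_cycle (R - {(a, b), (b, a)}) C"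
    if "rel_cycle R C" "{a, b} \<notin> cyclic_edges C" for a b C
  proof -
    have "{c, d} \<in> cyclic_edges C" if "(c, d) \<in> cyclic_arcs C" for c d
      using imageI[OF that, of "\<lambda>(u, v). {u, v}"] by (simp add: cyclic_edges_def)
    from this[of a b] this[of b a] show ?thesis
      using that by (auto simp: rel_cycle_def insert_commute)
  qed
  have C: "finite \<C>" "\<And>C. C \<in> \<C> \<Longrightarrow> rel_cycle R C"
    "\<And>C D. C \<in> \<C> \<Longrightarrow> D \<in> \<C> \<Longrightarrow> C \<noteq> D \<Longrightarrow> set C \<inter> set D = {}"
    using disj by (auto simp: disjoint_cycles_def)
  have l: "3 \<le> length us" "distinct us" using us by (auto simp: rel_cycle_def)
  have covered: "\<exists>C\<in>\<C>. {a, b} \<in> cyclic_edges C" if ab: "(a, b) \<in> cyclic_arcs us" for a b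
  proof (rule ccontr)
    assume "\<not> ?thesis"
    then have "disjoint_cycles (R - {(a, b), (b, a)}) \<C>"
      using C still_cycle unfolding disjoint_cycles_def by blast
    then show False using contra us ab by blast
  qed
  have arc: "(us ! i, us ! (Suc i mod length us)) \<in> cyclic_arcs us" if "i < length us" for i
    using that by (auto simp: cyclic_arcs_conv_nth)
  have in_set: "a \<in> set C" "b \<in> set C" if "{a, b} \<in> cyclic_edges C" for a b and C :: "'a list"
    using that Union_cyclic_edges[of C] by blast+
  have "0 < length us" using l by linarith
  from covered[OF arc[OF this]] obtain C where C': "C \<in> \<C>" "{us ! 0, us ! (Suc 0 mod length us)} \<in> cyclic_edges C"
    by blast
  note C0 = C'(1) in_set(1)[OF C'(2)]
  \<comment> \<open>Consecutive edges of \<open>us\<close> share a vertex, so the member of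
    \<open>\<C>\<close> that contains them cannot change along the cycle.\<close>
  have in_C: "us ! i \<in> set C" if "i < length us" for i
    using that
  proof (induction i)
    case (Suc i)
    then obtain D where D: "D \<in> \<C>" "{us ! i, us ! Suc i} \<in> cyclic_edges D"
      using covered[OF arc[of i]] by auto
    then have "D = C" using in_set[OF D(2)] Suc C(3)[OF D(1) C0(1)] by auto
    then show ?case using in_set[OF D(2)] by simp
  qed (use C0 in simp)
  then have us_sub: "set us \<subseteq> set C" by (auto simp: in_set_conv_nth)
  have sub: "cyclic_edges us \<subseteq> cyclic_edges C"
  proof
    fix e assume "e \<in> cyclic_edges us"
    then obtain a b where ab: "(a, b) \<in> cyclic_arcs us" "e = {a, b}" by (auto simp: cyclic_edges_def)
    then obtain D where D: "D \<in> \<C>" "{a, b} \<in> cyclic_edges D" using covered by blast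
    have "a \<in> set C" using cyclic_arcs_in_set(1)[OF ab(1)] us_sub by auto
    then have "D = C" using in_set[OF D(2)] C(3)[OF D(1) C0(1)] by auto
    then show "e \<in> cyclic_edges C" using D ab by simp
  qed
  have "cyclic_edges C \<subseteq> cyclic_edges us"
  proof (rule ccontr)
    assume "\<not> ?thesis"
    then obtain a b where ab: "(a, b) \<in> cyclic_arcs C" "{a, b} \<notin> cyclic_edges us"
      by (auto simp: cyclic_edges_def)
    \<comment> \<open>As \<open>us\<close> stays inside \<open>set C\<close>, it can replace
      \<open>C\<close> in the family, which frees the edge of \<open>C\<close> that
      \<open>us\<close> misses.\<close>
    let ?D = "insert us (\<C> - {C})" and ?R = "R - {(a, b), (b, a)}"
    have others: "set us \<inter> set D = {}" if "D \<in> \<C> - {C}" for D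
      using C(3)[OF C0(1), of D] that us_sub by auto
    have "us \<noteq> []" using l(1) by auto
    then have "us \<notin> \<C> - {C}" using others[of us] by auto
    then have "card ?D = Suc (card (\<C> - {C}))" using C(1) by simp
    also have "\<dots> = card \<C>" by (rule card_Suc_Diff1[OF C(1) C0(1)])
    finally have "card ?D = card \<C>" .
    moreover have "disjoint_cycles ?R ?D"
      unfolding disjoint_cycles_def
    proof (intro conjI ballI impI)
      fix D assume D: "D \<in> ?D"
      show "rel_cycle ?R D"
      proof (cases "D = us")
        case False
        then have D': "D \<in> \<C>" "D \<noteq> C" using D by auto
        then have "a \<notin> set D" using C(3)[OF C0(1) D'(1)] cyclic_arcs_in_set[OF ab(1)] by auto
        then have "{a, b} \<notin> cyclic_edges D" using in_set(1)[of a b D] by blast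
        then show ?thesis by (rule still_cycle[OF C(2)[OF D'(1)]])
      qed (use still_cycle us ab in simp)
    next
      fix D E assume "D \<in> ?D" "E \<in> ?D" "D \<noteq> E"
      then show "set D \<inter> set E = {}" using C(3) others by (auto simp: Int_commute)
    qed (use C in simp)
    ultimately show False using contra C(2)[OF C0(1)] ab(1) by blast
  qed
  then show ?thesis using sub C0 by blast
qed

section \<open>Matchings\<close>

definition rel_matching :: "'a rel \<Rightarrow> 'a set set \<Rightarrow> bool" where
  "rel_matching R M \<longleftrightarrow> M \<subseteq> (\<lambda>(u, v). {u, v}) ` R \<and> (\<forall>e\<in>M. \<forall>f\<in>M. e \<noteq> f \<longrightarrow> e \<inter> f = {})"

lemma rel_matching_Un:
  assumes "rel_matching R M" "rel_matching R N" "\<Union>M \<inter> \<Union>N = {}"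
  shows "rel_matching R (M \<union> N)"
proof -
  have disj: "e \<inter> f = {}" if "e \<in> M" "f \<in> N" for e f using that assms(3) by blast
  have "e \<inter> f = {}" if "e \<in> M \<union> N" "f \<in> M \<union> N" "e \<noteq> f" for e f
    using that(1,2)
  proof (elim UnE)
    assume "e \<in> M" "f \<in> M"
    then show ?thesis using assms(1) \<open>e \<noteq> f\<close> by (simp add: rel_matching_def)
  next
    assume "e \<in> N" "f \<in> N"
    then show ?thesis using assms(2) \<open>e \<noteq> f\<close> by (simp add: rel_matching_def)
  next
    assume "e \<in> M" "f \<in> N"
    then show ?thesis by (rule disj)
  next
    assume "e \<in> N" "f \<in> M"
    then show ?thesis using disj[of f e] by (simp add: Int_commute)
  qed
  then show ?thesis using assms(1,2) by (simp add: rel_matching_def)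
qed

lemma rel_matching_nonempty: "rel_matching R M \<Longrightarrow> {} \<notin> M"
  by (auto simp: rel_matching_def)

lemma rel_matching_disjoint_Unions:
  assumes "rel_matching R N" "\<Union>M \<inter> \<Union>N = {}"
  shows "M \<inter> N = {}"
proof (rule equals0I)
  fix e assume e: "e \<in> M \<inter> N"
  then have "e \<subseteq> \<Union>M \<inter> \<Union>N" by auto
  then show False using e rel_matching_nonempty[OF assms(1)] assms(2) by auto
qed

lemma rel_matching_mono: "rel_matching R M \<Longrightarrow> R \<subseteq> R' \<Longrightarrow> rel_matching R' M"
  unfolding rel_matching_def by (meson image_mono order_trans)

lemma rel_matching_subset: "rel_matching R M \<Longrightarrow> N \<subseteq> M \<Longrightarrow> rel_matching R N"
  unfolding rel_matching_def by (meson subsetD order_trans)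

context finite_symmetric_relation
begin

lemma rel_matching_finite: "rel_matching R M \<Longrightarrow> finite M"
  unfolding rel_matching_def by (meson finite_imageI finite_rel finite_subset)

lemma rel_matching_edge:
  assumes "rel_matching R M" "e \<in> M"
  obtains u v where "e = {u, v}" "(u, v) \<in> R" "u \<noteq> v"
proof -
  from assms obtain p where "p \<in> R" "e = (\<lambda>(u, v). {u, v}) p" unfolding rel_matching_def by auto
  moreover obtain u v where "p = (u, v)" by (cases p)
  ultimately show thesis using that[of u v] rel_irrefl by auto
qed

lemma rel_matching_subset_verts: "rel_matching R M \<Longrightarrow> \<Union>M \<subseteq> V"
  unfolding rel_matching_def using rel_subset by auto

lemma card_Union_rel_matching:
  assumes "rel_matching R M" shows "card (\<Union>M) = 2 * card M"
proof -
  have "card (\<Union>M) = sum card M"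
  proof (rule card_Union_disjoint)
    show "pairwise disjnt M"
      using assms by (auto simp: rel_matching_def pairwise_def disjnt_def)
  qed (use assms rel_matching_edge in \<open>metis finite.emptyI finite_insert\<close>)
  also have "\<dots> = (\<Sum>e\<in>M. 2)"
    by (rule sum.cong[OF refl], rule rel_matching_edge[OF assms]) auto
  finally show ?thesis by simp
qed

text \<open>Consecutive vertices are paired. This covers even cycles, odd cycles cut open at one
  vertex, and orbits of length 2, which are single edges.\<close>

lemma perfect_matching_even_path:
  assumes "even (length xs)" "distinct xs" "\<And>i. Suc i < length xs \<Longrightarrow> (xs ! i, xs ! Suc i) \<in> R"
  shows "\<exists>M. rel_matching R M \<and> \<Union>M = set xs"
  using assms
proof (induction xs rule: induct_list012)
  case 1
  then show ?case by (intro exI[of _ "{}"]) (auto simp: rel_matching_def)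
next
  case (3 x y zs)
  have "(zs ! i, zs ! Suc i) \<in> R" if "Suc i < length zs" for i
    using "3.prems"(3)[of "Suc (Suc i)"] that by simp
  then obtain M where M: "rel_matching R M" "\<Union>M = set zs" using 3 by auto
  have "(x, y) \<in> R" using "3.prems"(3)[of 0] by simp
  then have "rel_matching R {{x, y}}" by (auto simp: rel_matching_def)
  moreover have "\<Union>{{x, y}} \<inter> \<Union>M = {}" using "3.prems"(2) M by auto
  ultimately have "rel_matching R ({{x, y}} \<union> M)" using M(1) by (intro rel_matching_Un)
  then show ?case using M by (intro exI[of _ "{{x, y}} \<union> M"]) auto
qed simp

lemma perfect_matching_even_cycle:
  assumes "rel_cycle R us" "even (length us)"
  shows "\<exists>M. rel_matching R M \<and> \<Union>M = set us"
proof (rule perfect_matching_even_path)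
  fix i assume "Suc i < length us"
  then have "(us ! i, us ! Suc i) \<in> cyclic_arcs us" unfolding cyclic_arcs_conv_nth by force
  then show "(us ! i, us ! Suc i) \<in> R" using assms by (auto simp: rel_cycle_def)
qed (use assms in \<open>auto simp: rel_cycle_def\<close>)

lemma matching_odd_cycle_avoiding:
  assumes us: "rel_cycle R us" "odd (length us)" and v: "v \<in> set us"
  shows "\<exists>M. rel_matching R M \<and> \<Union>M = set us - {v}"
proof -
  from v obtain j where j: "j < length us" "us ! j = v" by (auto simp: in_set_conv_nth)
  define vs where "vs = rotate j us"
  have vs: "rel_cycle R vs" "length vs = length us" "set vs = set us" using us by (simp_all add: vs_def)
  have "us \<noteq> []" using v by auto
  then have "hd vs = v" using j hd_rotate_conv_nth[of us j] by (simp add: vs_def)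
  then obtain ws where ws: "vs = v # ws" using \<open>us \<noteq> []\<close> vs(2) by (cases vs) auto
  have "\<exists>M. rel_matching R M \<and> \<Union>M = set ws"
  proof (rule perfect_matching_even_path)
    fix i assume "Suc i < length ws"
    then have "(vs ! Suc i, vs ! Suc (Suc i)) \<in> cyclic_arcs vs"
      unfolding cyclic_arcs_conv_nth using ws by force
    then show "(ws ! i, ws ! Suc i) \<in> R" using vs(1) ws by (auto simp: rel_cycle_def)
  next
    show "even (length ws)" by (metis even_Suc length_Cons vs(2) ws us(2))
    show "distinct ws" using vs(1) ws by (simp add: rel_cycle_def)
  qed
  moreover have "set ws = set us - {v}" using vs ws by (auto simp: rel_cycle_def)
  ultimately show ?thesis by simp
qed

text \<open>An odd cycle that \<open>M\<close> touches in at most one vertex \<open>v\<close> has a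
  perfect matching of its other vertices. Used both for matchings that avoid the cycles and for
  matchings lifted from the contraction, where one vertex per cycle may be occupied.\<close>

lemma extend_matching_by_odd_cycles:
  assumes M: "rel_matching R M" and \<C>: "disjoint_cycles R \<C>" and odd: "\<And>C. C \<in> \<C> \<Longrightarrow> odd (length C)"
    and v: "\<And>C. C \<in> \<C> \<Longrightarrow> \<exists>v\<in>set C. \<Union>M \<inter> set C \<subseteq> {v}"
  shows "\<exists>N. rel_matching R N \<and> 2 * card N + card \<C> = 2 * card M + (\<Sum>C\<in>\<C>. length C)"
proof -
  have "finite \<C>" using \<C> by (simp add: disjoint_cycles_def)
  \<comment> \<open>The added inclusion keeps the induction going: it shows that \<open>N\<close>
    meets the next cycle only where \<open>M\<close> does.\<close>
  then have "\<exists>N. rel_matching R N \<and> 2 * card N + card \<C> = 2 * card M + (\<Sum>C\<in>\<C>. length C)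
      \<and> \<Union>N \<subseteq> \<Union>M \<union> (\<Union>C\<in>\<C>. set C)"
    using \<C> odd v
  proof (induction \<C> rule: finite_induct)
    case empty
    then show ?case using M by auto
  next
    case (insert C \<C>)
    have "disjoint_cycles R \<C>" using insert.prems by (auto simp: disjoint_cycles_def)
    then obtain N where N: "rel_matching R N"
      "2 * card N + card \<C> = 2 * card M + (\<Sum>C\<in>\<C>. length C)" "\<Union>N \<subseteq> \<Union>M \<union> (\<Union>C\<in>\<C>. set C)"
      using insert by auto
    from insert.prems(3)[of C] obtain v where v: "v \<in> set C" "\<Union>M \<inter> set C \<subseteq> {v}" by auto
    have C: "rel_cycle R C" "odd (length C)" using insert.prems by (auto simp: disjoint_cycles_def)
    obtain M' where M': "rel_matching R M'" "\<Union>M' = set C - {v}"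
      using matching_odd_cycle_avoiding[OF C v(1)] by blast
    have "set C \<inter> set D = {}" if "D \<in> \<C>" for D
      using insert.prems(1) insert.hyps(2) that unfolding disjoint_cycles_def by auto
    then have disj: "\<Union>N \<inter> \<Union>M' = {}" using N(3) v(2) M'(2) by blast
    have "2 * card M' = card (set C - {v})" using card_Union_rel_matching[OF M'(1)] M'(2) by simp
    also have "\<dots> + 1 = length C"
      using v(1) C(1) distinct_card[of C] card_Suc_Diff1[of "set C" v] by (simp add: rel_cycle_def)
    finally have cM': "2 * card M' + 1 = length C" by simp
    have "card (N \<union> M') = card N + card M'"
      using rel_matching_disjoint_Unions[OF M'(1) disj] N(1) M'(1) rel_matching_finite
      by (intro card_Un_disjoint) auto
    then have "2 * card (N \<union> M') + card (insert C \<C>) = 2 * card M + (\<Sum>C\<in>insert C \<C>. length C)"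
      using N(2) cM' insert.hyps by simp
    moreover have "\<Union>(N \<union> M') \<subseteq> \<Union>M \<union> (\<Union>C\<in>insert C \<C>. set C)" using N(3) M'(2) by auto
    ultimately show ?case using rel_matching_Un[OF N(1) M'(1) disj] by blast
  qed
  then show ?thesis by blast
qed

section \<open>Decomposing a permutation along arcs into a matching and odd cycles\<close>

text \<open>The list is \<open>x\<close>, \<open>\<sigma> x\<close>, and so on up to the first
  return to \<open>x\<close>. By injectivity any repetition can be cancelled down to a return to
  \<open>x\<close> itself, so there is no earlier repetition.\<close>

lemma permutation_orbit_list:
  assumes S: "finite S" "bij_betw \<sigma> S S" and x: "x \<in> S"
  shows "\<exists>us. us \<noteq> [] \<and> distinct us \<and> set us \<subseteq> S \<and> x \<in> set us
     \<and> (\<forall>i<length us. \<sigma> (us ! i) = us ! (Suc i mod length us))"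
proof -
  have inS: "(\<sigma> ^^ i) x \<in> S" for i
    using x S(2) by (induction i) (auto simp: bij_betw_def)
  have cancel: "(\<sigma> ^^ (j - i)) x = x" if "i \<le> j" "(\<sigma> ^^ i) x = (\<sigma> ^^ j) x" for i j
    using that
  proof (induction i arbitrary: j)
    case (Suc i)
    then obtain k where k: "j = Suc k" by (cases j) auto
    then have "\<sigma> ((\<sigma> ^^ i) x) = \<sigma> ((\<sigma> ^^ k) x)" using Suc.prems by simp
    then have "(\<sigma> ^^ i) x = (\<sigma> ^^ k) x" using S(2) inS by (meson bij_betw_def inj_onD)
    then show ?case using Suc k by simp
  qed simp
  have "\<not> inj_on (\<lambda>i. (\<sigma> ^^ i) x) {..card S}"
    using card_inj_on_le[of "\<lambda>i. (\<sigma> ^^ i) x" "{..card S}" S] inS S(1) by auto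
  then obtain i j where "i < j" "(\<sigma> ^^ i) x = (\<sigma> ^^ j) x"
    by (auto simp: inj_on_def) (metis linorder_neqE_nat)
  then have "\<exists>l>0. (\<sigma> ^^ l) x = x" using cancel[of i j] by (intro exI[of _ "j - i"]) auto
  define l where "l = (LEAST l. 0 < l \<and> (\<sigma> ^^ l) x = x)"
  have l: "0 < l" "(\<sigma> ^^ l) x = x"
    using LeastI_ex[OF \<open>\<exists>l>0. _ l\<close>] by (auto simp: l_def)
  have least: "(\<sigma> ^^ k) x \<noteq> x" if "0 < k" "k < l" for k
    using not_less_Least[of k "\<lambda>l. 0 < l \<and> (\<sigma> ^^ l) x = x"] that by (auto simp: l_def)
  define us where "us = map (\<lambda>i. (\<sigma> ^^ i) x) [0..<l]"
  have "inj_on (\<lambda>i. (\<sigma> ^^ i) x) {0..<l}"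
  proof (rule linorder_inj_onI)
    fix i j assume "i < j" "i \<in> {0..<l}" "j \<in> {0..<l}"
    then show "(\<sigma> ^^ i) x \<noteq> (\<sigma> ^^ j) x" using cancel[of i j] least[of "j - i"] by auto
  qed auto
  then have "distinct us" by (simp add: us_def distinct_map)
  moreover have "\<sigma> (us ! i) = us ! (Suc i mod length us)" if "i < length us" for i
    using that l by (cases "Suc i = l") (auto simp: us_def)
  moreover have "x \<in> set us" using l by (force simp: us_def)
  moreover have "set us \<subseteq> S" using inS by (auto simp: us_def)
  moreover have "us \<noteq> []" using l by (simp add: us_def)
  ultimately show ?thesis by blast
qed

text \<open>Orbits are peeled off one at a time. Irreflexivity excludes fixed points, even orbits
  (including single edges) are absorbed into the matching, and only odd orbits remain as
  cycles.\<close>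

lemma permutation_along_arcs_decomposition:
  assumes "finite S" "bij_betw \<sigma> S S" "\<And>x. x \<in> S \<Longrightarrow> (x, \<sigma> x) \<in> R"
  shows "\<exists>M \<C>. rel_matching R M \<and> disjoint_cycles R \<C> \<and> (\<forall>C\<in>\<C>. odd (length C))
     \<and> \<Union>M \<union> (\<Union>C\<in>\<C>. set C) = S \<and> \<Union>M \<inter> (\<Union>C\<in>\<C>. set C) = {}"
  using assms
proof (induction "card S" arbitrary: S rule: less_induct)
  case less
  show ?case
  proof (cases "S = {}")
    case True
    then show ?thesis
      by (intro exI[of _ "{}"]) (auto simp: rel_matching_def disjoint_cycles_def)
  next
    case False
    then obtain x where x: "x \<in> S" by auto
    obtain us where us: "us \<noteq> []" "distinct us" "set us \<subseteq> S" "x \<in> set us"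
      "\<And>i. i < length us \<Longrightarrow> \<sigma> (us ! i) = us ! (Suc i mod length us)"
      using permutation_orbit_list[OF less.prems(1,2) x] by blast
    have sub: "\<sigma> ` set us \<subseteq> set us"
      using us by (auto simp: in_set_conv_nth) (metis length_greater_0_conv mod_less_divisor)
    have inj: "inj_on \<sigma> (set us)" using less.prems(2) us(3) by (meson bij_betw_def inj_on_subset)
    have "bij_betw \<sigma> (set us) (set us)"
      using inj endo_inj_surj[OF _ sub inj] by (simp add: bij_betw_def)
    then have "bij_betw \<sigma> (S - set us) (S - set us)"
      by (intro bij_betw_DiffI less.prems(2) us(3))
    moreover have "card (S - set us) < card S"
      using x us(4) less.prems(1) by (intro psubset_card_mono) auto
    moreover have "finite (S - set us)" "\<And>y. y \<in> S - set us \<Longrightarrow> (y, \<sigma> y) \<in> R"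
      using less.prems by auto
    ultimately have "\<exists>M \<C>. rel_matching R M \<and> disjoint_cycles R \<C> \<and> (\<forall>C\<in>\<C>. odd (length C))
      \<and> \<Union>M \<union> (\<Union>C\<in>\<C>. set C) = S - set us \<and> \<Union>M \<inter> (\<Union>C\<in>\<C>. set C) = {}"
      by (intro less.hyps)
    then obtain M \<C> where IH: "rel_matching R M" "disjoint_cycles R \<C>" "\<forall>C\<in>\<C>. odd (length C)"
      "\<Union>M \<union> (\<Union>C\<in>\<C>. set C) = S - set us" "\<Union>M \<inter> (\<Union>C\<in>\<C>. set C) = {}"
      by (elim exE conjE)
    have arc: "(us ! i, us ! (Suc i mod length us)) \<in> R" if "i < length us" for i
      using less.prems(3)[OF subsetD[OF us(3) nth_mem[OF that]]] us(5)[OF that] by simp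
    have cyc: "rel_cycle R us" if "3 \<le> length us"
      using arc that us(2) by (auto simp: rel_cycle_def cyclic_arcs_conv_nth)
    have even: ?thesis if "rel_matching R N" "\<Union>N = set us" for N
    proof -
      have "\<Union>M \<inter> \<Union>N = {}" using IH(4) that by blast
      then have "rel_matching R (M \<union> N)" by (rule rel_matching_Un[OF IH(1) that(1)])
      moreover have "\<Union>(M \<union> N) \<union> (\<Union>C\<in>\<C>. set C) = S" using IH(4) that us(3) by auto
      moreover have "\<Union>(M \<union> N) \<inter> (\<Union>C\<in>\<C>. set C) = {}" using IH(4,5) that by auto
      ultimately show ?thesis
        using IH(2,3) by (intro exI[of _ "M \<union> N"] exI[of _ \<C>]) simp
    qed
    have "length us \<noteq> 0" using us(1) by simp
    then have "length us = 1 \<or> length us = 2 \<or> 3 \<le> length us" by linarith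
    then consider "length us = 1" | "length us = 2" | "3 \<le> length us" "even (length us)"
      | "3 \<le> length us" "odd (length us)"
      by blast
    then show ?thesis
    proof cases
      case 1
      then show ?thesis using arc[of 0] rel_irrefl by auto
    next
      case 2
      have "\<exists>N. rel_matching R N \<and> \<Union>N = set us"
      proof (rule perfect_matching_even_path)
        fix i assume "Suc i < length us"
        then show "(us ! i, us ! Suc i) \<in> R" using arc[of i] by simp
      qed (use 2 us(2) in auto)
      then show ?thesis using even by (elim exE conjE)
    next
      case 3
      from perfect_matching_even_cycle[OF cyc[OF 3(1)] 3(2)] even show ?thesis
        by (elim exE conjE)
    next
      case 4
      have "\<forall>C\<in>\<C>. set C \<inter> set us = {}" using IH(4) by auto
      then have "disjoint_cycles R (insert us \<C>)"
        using IH(2) cyc 4 unfolding disjoint_cycles_def by (auto simp: Int_commute)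
      moreover have "\<forall>C\<in>insert us \<C>. odd (length C)" using 4 IH(3) by auto
      moreover have "\<Union>M \<union> (\<Union>C\<in>insert us \<C>. set C) = S" using IH(4) us(3) by auto
      moreover have "\<Union>M \<inter> (\<Union>C\<in>insert us \<C>. set C) = {}" using IH(4,5) by auto
      ultimately show ?thesis
        using IH(1) by (intro exI[of _ M] exI[of _ "insert us \<C>"]) simp
    qed
  qed
qed

end

section \<open>Acyclic relations and vertex covers\<close>

context finite_symmetric_relation
begin

lemma restrict: "A \<subseteq> V \<Longrightarrow> finite_symmetric_relation A (R \<inter> A \<times> A)"
  using rel_sym rel_irrefl finite_subset[OF _ finite_verts] by unfold_locales auto

text \<open>In a longest path all neighbours of the first vertex lie on the path; one other than the
  second vertex closes a cycle of length at least 3.\<close>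

lemma min_degree_two_imp_cycle:
  assumes "V \<noteq> {}" "\<And>v. v \<in> V \<Longrightarrow> 2 \<le> card (R `` {v})"
  shows "\<exists>us. rel_cycle R us"
proof -
  define path where "path = (\<lambda>xs. xs \<noteq> [] \<and> distinct xs \<and> set xs \<subseteq> V
    \<and> (\<forall>i. Suc i < length xs \<longrightarrow> (xs ! i, xs ! Suc i) \<in> R))"
  obtain v where "v \<in> V" using assms(1) by auto
  then have "path [v]" by (simp add: path_def)
  moreover have "\<forall>xs. path xs \<longrightarrow> length xs < Suc (card V)"
  proof (intro allI impI)
    fix xs assume "path xs"
    then show "length xs < Suc (card V)"
      unfolding path_def using card_mono[OF finite_verts, of "set xs"] distinct_card[of xs] by simp
  qed
  ultimately have "\<exists>xs. path xs \<and> (\<forall>ys. path ys \<longrightarrow> length ys \<le> length xs)"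
    by (rule ex_has_greatest_nat)
  then obtain xs where xs: "path xs" "\<forall>ys. path ys \<longrightarrow> length ys \<le> length xs"
    by (elim exE conjE)
  have p: "xs \<noteq> []" "distinct xs" "set xs \<subseteq> V" "\<And>i. Suc i < length xs \<Longrightarrow> (xs ! i, xs ! Suc i) \<in> R"
    using xs(1) by (simp_all add: path_def)
  have nbr: "w \<in> set xs" if w: "(xs ! 0, w) \<in> R" for w
  proof (rule ccontr)
    assume "w \<notin> set xs"
    moreover have "((w # xs) ! i, (w # xs) ! Suc i) \<in> R" if "Suc i < length (w # xs)" for i
      using p(4) w that rel_sym by (cases i) auto
    ultimately have "path (w # xs)" using p w rel_in_verts by (simp add: path_def)
    then show False using xs(2) by fastforce
  qed
  have "xs ! 0 \<in> V" using p by auto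
  then have "\<not> R `` {xs ! 0} \<subseteq> {xs ! 1}"
    using assms(2)[of "xs ! 0"] card_mono[of "{xs ! 1}" "R `` {xs ! 0}"] by auto
  then obtain w where w: "(xs ! 0, w) \<in> R" "w \<noteq> xs ! 1" by auto
  obtain j where j: "j < length xs" "xs ! j = w" using nbr[OF w(1)] by (auto simp: in_set_conv_nth)
  have "j \<noteq> 0" using j(2) w(1) rel_irrefl[of "xs ! 0"] by (intro notI) simp
  moreover have "j \<noteq> 1" using j(2) w(2) by auto
  ultimately have j2: "2 \<le> j" by simp
  let ?us = "take (Suc j) xs"
  have len: "length ?us = Suc j" using j by simp
  have "cyclic_arcs ?us \<subseteq> R"
  proof
    fix e assume "e \<in> cyclic_arcs ?us"
    then obtain i where i: "i < Suc j" "e = (?us ! i, ?us ! (Suc i mod Suc j))"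
      unfolding cyclic_arcs_conv_nth len by auto
    then show "e \<in> R"
      using p(4)[of i] j w(1) rel_sym by (cases "i = j") auto
  qed
  then have "rel_cycle R ?us" using p(2) j2 len by (simp add: rel_cycle_def)
  then show ?thesis by blast
qed

end

text \<open>Some vertex has degree at most one, and deleting it costs at most two arcs. Forests are
  included, so connectedness is not assumed.\<close>

lemma (in finite_symmetric_relation) acyclic_card_rel:
  assumes "V \<noteq> {}" "\<nexists>us. rel_cycle R us"
  shows "card R + 2 \<le> 2 * card V"
  using assms finite_symmetric_relation_axioms
proof (induction "card V" arbitrary: V R rule: less_induct)
  case less
  interpret finite_symmetric_relation V R by fact
  have "\<exists>v\<in>V. card (R `` {v}) \<le> 1"
  proof (rule ccontr)
    assume "\<not> ?thesis"
    then have "2 \<le> card (R `` {v})" if "v \<in> V" for v using that by force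
    from min_degree_two_imp_cycle[OF less.prems(1) this] less.prems(2) show False by simp
  qed
  then obtain v where v: "v \<in> V" "card (R `` {v}) \<le> 1" by blast
  let ?V = "V - {v}"
  let ?R = "R \<inter> ?V \<times> ?V"
  interpret R': finite_symmetric_relation ?V ?R by (rule restrict) auto
  have cV: "card V = Suc (card ?V)" using card_Suc_Diff1[OF finite_verts v(1)] by simp
  have fin: "finite (R `` {v})" by simp
  have "R \<subseteq> ?R \<union> ({v} \<times> R `` {v} \<union> R `` {v} \<times> {v})" using rel_subset rel_sym by auto
  then have "card R \<le> card (?R \<union> ({v} \<times> R `` {v} \<union> R `` {v} \<times> {v}))" using fin by (intro card_mono) auto
  also have "\<dots> \<le> card ?R + card ({v} \<times> R `` {v} \<union> R `` {v} \<times> {v})" by (rule card_Un_le)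
  also have "\<dots> \<le> card ?R + (card ({v} \<times> R `` {v}) + card (R `` {v} \<times> {v}))"
    using card_Un_le[of "{v} \<times> R `` {v}" "R `` {v} \<times> {v}"] by simp
  also have "\<dots> \<le> card ?R + 2" using v(2) by (simp add: card_cartesian_product)
  finally have cR: "card R \<le> card ?R + 2" .
  show ?case
  proof (cases "?V = {}")
    case True
    then have "V = {v}" using v by auto
    then have "R = {}" using rel_subset rel_irrefl by auto
    then show ?thesis using cV by simp
  next
    case False
    have "\<nexists>us. rel_cycle ?R us" using less.prems(2) by (auto simp: rel_cycle_def)
    then have "card ?R + 2 \<le> 2 * card ?V"
      using less.hyps[of ?V ?R] False cV R'.finite_symmetric_relation_axioms by simp
    then show ?thesis using cR cV by simp
  qed
qed

definition vertex_cover :: "'a rel \<Rightarrow> 'a set \<Rightarrow> bool" where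
  "vertex_cover R K \<longleftrightarrow> (\<forall>(u, v)\<in>R. u \<in> K \<or> v \<in> K)"

lemma vertex_coverD: "vertex_cover R K \<Longrightarrow> (u, v) \<in> R \<Longrightarrow> u \<in> K \<or> v \<in> K"
  by (auto simp: vertex_cover_def)

text \<open>1-degeneracy is acyclicity in the form that leaf induction consumes. For the contraction
  it follows from counting arcs, so cycles of classes never have to be lifted to cycles of
  vertices.\<close>

definition degenerate_rel :: "'a set \<Rightarrow> 'a rel \<Rightarrow> bool" where
  "degenerate_rel V R \<longleftrightarrow> (\<forall>A\<subseteq>V. A \<noteq> {} \<longrightarrow> (\<exists>v\<in>A. card (R `` {v} \<inter> A) \<le> 1))"

lemma degenerate_rel_restrict:
  assumes "degenerate_rel V R" "finite V" "B \<subseteq> V" shows "degenerate_rel B (R \<inter> B \<times> B)"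
  unfolding degenerate_rel_def
proof (intro allI impI)
  fix A assume A: "A \<subseteq> B" "A \<noteq> {}"
  then obtain v where v: "v \<in> A" "card (R `` {v} \<inter> A) \<le> 1"
    using assms(1,3) unfolding degenerate_rel_def by (meson order_trans)
  have "finite A" using A assms finite_subset by metis
  then have "card ((R \<inter> B \<times> B) `` {v} \<inter> A) \<le> card (R `` {v} \<inter> A)" by (intro card_mono) auto
  then show "\<exists>v\<in>A. card ((R \<inter> B \<times> B) `` {v} \<inter> A) \<le> 1" using v by (meson order_trans)
qed

text \<open>If all degrees inside \<open>A\<close> were at least 2, then \<open>A\<close> would
  carry \<open>2 * card A\<close> arcs, and joining the remaining vertices to \<open>A\<close> takes
  two more arcs each, exceeding the bound.\<close>

lemma (in finite_symmetric_relation) tree_degenerate: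
  assumes conn: "connected_rel V R" and card: "card R + 2 \<le> 2 * card V"
  shows "degenerate_rel V R"
  unfolding degenerate_rel_def
proof (intro allI impI, rule ccontr)
  fix A assume A: "A \<subseteq> V" "A \<noteq> {}" and "\<not> (\<exists>v\<in>A. card (R `` {v} \<inter> A) \<le> 1)"
  then have deg: "2 \<le> card (R `` {v} \<inter> A)" if "v \<in> A" for v using that by force
  have fA: "finite A" using A(1) finite_verts finite_subset by blast
  have "R \<inter> A \<times> A = (SIGMA v:A. R `` {v} \<inter> A)" by auto
  then have "card (R \<inter> A \<times> A) = (\<Sum>v\<in>A. card (R `` {v} \<inter> A))" using fA by simp
  moreover have "(\<Sum>v\<in>A. 2) \<le> (\<Sum>v\<in>A. card (R `` {v} \<inter> A))" by (rule sum_mono) (rule deg)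
  ultimately have "2 * card A \<le> card (R \<inter> A \<times> A)" by simp
  moreover have "card (V - A) = card V - card A" "card A \<le> card V"
    using A(1) fA by (simp_all add: card_Diff_subset card_mono)
  ultimately show False using connected_card_rel[OF conn A] card by simp
qed

text \<open>Induction by deleting a leaf together with its neighbour, which goes into the cover.\<close>

lemma (in finite_symmetric_relation) koenig_degenerate:
  assumes "degenerate_rel V R"
  shows "\<exists>K M. K \<subseteq> V \<and> vertex_cover R K \<and> rel_matching R M \<and> card M = card K"
  using assms finite_symmetric_relation_axioms
proof (induction "card V" arbitrary: V R rule: less_induct)
  case less
  interpret finite_symmetric_relation V R by fact
  show ?case
  proof (cases "V = {}")
    case True
    then have "R = {}" using rel_subset by auto
    then show ?thesis
      by (intro exI[of _ "{}"]) (auto simp: vertex_cover_def rel_matching_def)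
  next
    case False
    then obtain v where v: "v \<in> V" "card (R `` {v} \<inter> V) \<le> 1"
      using less.prems(1) unfolding degenerate_rel_def by blast
    have nV: "R `` {v} \<inter> V = R `` {v}" using rel_subset by auto
    have fin: "finite (R `` {v})" by simp
    have smaller: "\<exists>K M. K \<subseteq> V - B \<and> vertex_cover (R \<inter> (V - B) \<times> (V - B)) K
      \<and> rel_matching (R \<inter> (V - B) \<times> (V - B)) M \<and> card M = card K" if "v \<in> B" for B
    proof (rule less.hyps)
      show "card (V - B) < card V" using v(1) that by (intro psubset_card_mono) auto
      show "degenerate_rel (V - B) (R \<inter> (V - B) \<times> (V - B))"
        by (rule degenerate_rel_restrict[OF less.prems(1)]) auto
      show "finite_symmetric_relation (V - B) (R \<inter> (V - B) \<times> (V - B))" by (rule restrict) auto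
    qed
    show ?thesis
    proof (cases "R `` {v} = {}")
      case True
      then have "R \<inter> (V - {v}) \<times> (V - {v}) = R" using rel_subset rel_sym by auto
      then show ?thesis using smaller[of "{v}"] by auto
    next
      case False
      then have "card (R `` {v}) = 1" using v(2) fin nV by (simp add: le_Suc_eq)
      then obtain u where u: "R `` {v} = {u}" by (auto simp: card_1_singleton_iff)
      then have uv: "(v, u) \<in> R" "(u, v) \<in> R" "u \<noteq> v" using rel_sym rel_irrefl by auto
      let ?R = "R \<inter> (V - {u, v}) \<times> (V - {u, v})"
      from smaller[of "{u, v}"] obtain K M where
        KM: "K \<subseteq> V - {u, v}" "vertex_cover ?R K" "rel_matching ?R M" "card M = card K" by auto
      interpret R': finite_symmetric_relation "V - {u, v}" ?R by (rule restrict) auto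
      have sub: "\<Union>M \<subseteq> V - {u, v}" by (rule R'.rel_matching_subset_verts[OF KM(3)])
      have "rel_matching R ({{u, v}} \<union> M)"
      proof (rule rel_matching_Un)
        show "rel_matching R {{u, v}}" using uv by (auto simp: rel_matching_def)
        show "rel_matching R M" by (rule rel_matching_mono[OF KM(3)]) auto
        show "\<Union>{{u, v}} \<inter> \<Union>M = {}" using sub by auto
      qed
      moreover have "{u, v} \<notin> M" "u \<notin> K" using sub KM(1) by auto
      then have "card ({{u, v}} \<union> M) = card (insert u K)"
        using KM R'.rel_matching_finite[OF KM(3)] finite_subset[OF KM(1)] by auto
      moreover have "vertex_cover R (insert u K)"
        unfolding vertex_cover_def
      proof safe
        fix a b assume ab: "(a, b) \<in> R" "b \<noteq> u" "b \<notin> K" "a \<notin> K"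
        show "a = u"
        proof (rule ccontr)
          assume "a \<noteq> u"
          then have "a \<noteq> v" "b \<noteq> v" using ab u rel_sym by auto
          then have "(a, b) \<in> ?R" using ab \<open>a \<noteq> u\<close> rel_in_verts by auto
          then show False using vertex_coverD[OF KM(2)] ab by blast
        qed
      qed
      moreover have "insert u K \<subseteq> V" using KM(1) uv rel_in_verts by auto
      ultimately show ?thesis by (intro exI[of _ "insert u K"] exI[of _ "{{u, v}} \<union> M"]) simp
    qed
  qed
qed

text \<open>The map itself is exported, not only the inequality of sizes: when the sizes agree it
  becomes a bijection, from which the partner map of a tight cover is read off.\<close>

lemma matching_into_cover:
  assumes "rel_matching R M" "vertex_cover R K"
  obtains g where "inj_on g M" "\<And>e. e \<in> M \<Longrightarrow> g e \<in> e" "\<And>e. e \<in> M \<Longrightarrow> g e \<in> K"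
proof -
  have "\<exists>k. k \<in> e \<and> k \<in> K" if "e \<in> M" for e
  proof -
    from assms(1) that obtain u v where "(u, v) \<in> R" "e = {u, v}" unfolding rel_matching_def by auto
    then show ?thesis using vertex_coverD[OF assms(2)] by blast
  qed
  then obtain g where g: "\<And>e. e \<in> M \<Longrightarrow> g e \<in> e" "\<And>e. e \<in> M \<Longrightarrow> g e \<in> K" by metis
  have "inj_on g M"
  proof (rule inj_onI, rule ccontr)
    fix e f assume "e \<in> M" "f \<in> M" "g e = g f" "e \<noteq> f"
    then show False using g(1)[of e] g(1)[of f] assms(1) unfolding rel_matching_def by auto
  qed
  then show thesis using that g by blast
qed

lemma matching_le_cover:
  assumes "rel_matching R M" "vertex_cover R K" "finite K"
  shows "card M \<le> card K"
proof -
  obtain g where "inj_on g M" "\<And>e. e \<in> M \<Longrightarrow> g e \<in> e" "\<And>e. e \<in> M \<Longrightarrow> g e \<in> K"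
    using matching_into_cover[OF assms(1,2)] by metis
  then show ?thesis using card_inj_on_le[of g M K] assms(3) by auto
qed

definition rel_matching_number :: "'a rel \<Rightarrow> nat" where
  "rel_matching_number R = Max (card ` {M. rel_matching R M})"

context finite_symmetric_relation
begin

lemma finite_card_matchings: "finite (card ` {M. rel_matching R M})"
proof -
  have "{M. rel_matching R M} \<subseteq> Pow ((\<lambda>(u, v). {u, v}) ` R)" by (auto simp: rel_matching_def)
  then show ?thesis using finite_subset by (meson finite_Pow_iff finite_imageI finite_rel)
qed

lemma rel_matching_number_ge: "rel_matching R M \<Longrightarrow> card M \<le> rel_matching_number R"
  unfolding rel_matching_number_def using finite_card_matchings by (intro Max_ge) auto

lemma rel_matching_number_attained:
  obtains M where "rel_matching R M" "card M = rel_matching_number R"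
proof -
  have "rel_matching R {}" by (simp add: rel_matching_def)
  then have "rel_matching_number R \<in> card ` {M. rel_matching R M}"
    unfolding rel_matching_number_def using finite_card_matchings by (intro Max_in) auto
  then show thesis using that by auto
qed

end

section \<open>Contracting a family of disjoint cycles\<close>

text \<open>Off the cycles this is a singleton. For disjoint cycles it agrees with
  \<open>contr_class\<close>, without a transitive closure.\<close>

definition cycle_class :: "'a list set \<Rightarrow> 'a \<Rightarrow> 'a set" where
  "cycle_class \<C> u = insert u (\<Union>{set C |C. C \<in> \<C> \<and> u \<in> set C})"

definition contracted_rel :: "'a list set \<Rightarrow> 'a rel \<Rightarrow> 'a set rel" where
  "contracted_rel \<C> R = {(cycle_class \<C> u, cycle_class \<C> v) |u v.
     (u, v) \<in> R \<and> cycle_class \<C> u \<noteq> cycle_class \<C> v}"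

text \<open>The arcs that would become loops: cycle arcs, and a priori also chords.\<close>

definition inner_rel :: "'a list set \<Rightarrow> 'a rel \<Rightarrow> 'a rel" where
  "inner_rel \<C> R = {(u, v) \<in> R. cycle_class \<C> u = cycle_class \<C> v}"

lemma contracted_relI:
  "(u, v) \<in> R \<Longrightarrow> cycle_class \<C> u \<noteq> cycle_class \<C> v
    \<Longrightarrow> (cycle_class \<C> u, cycle_class \<C> v) \<in> contracted_rel \<C> R"
  unfolding contracted_rel_def by blast

lemma contracted_relE:
  assumes "(X, Y) \<in> contracted_rel \<C> R"
  obtains u v where "X = cycle_class \<C> u" "Y = cycle_class \<C> v" "(u, v) \<in> R"
    "cycle_class \<C> u \<noteq> cycle_class \<C> v"
  using assms unfolding contracted_rel_def by blast

text \<open>\<open>card_rel\<close> says that \<open>\<C>\<close> has as many members as the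
  cyclomatic number, the most that disjoint cycles can reach.\<close>

locale maximal_disjoint_cycles = finite_symmetric_relation V R
  for V :: "'a set" and R :: "'a rel" +
  fixes \<C> :: "'a list set"
  assumes connected: "connected_rel V R" and nonempty: "V \<noteq> {}"
    and disjoint: "disjoint_cycles R \<C>"
    and card_rel: "card R + 2 = 2 * card V + 2 * card \<C>"
begin

abbreviation "cls \<equiv> cycle_class \<C>"
abbreviation "O\<C> \<equiv> \<Union>C\<in>\<C>. set C"
abbreviation "T \<equiv> contracted_rel \<C> R"

lemma finite_cycles [simp]: "finite \<C>"
  using disjoint by (simp add: disjoint_cycles_def)

lemma cycle_in: "C \<in> \<C> \<Longrightarrow> rel_cycle R C"
  using disjoint by (simp add: disjoint_cycles_def)

lemma cycle_nonempty: "C \<in> \<C> \<Longrightarrow> \<exists>u. u \<in> set C"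
  using cycle_in[of C] by (cases C) (auto simp: rel_cycle_def)

lemma cycles_disjointD: "C \<in> \<C> \<Longrightarrow> D \<in> \<C> \<Longrightarrow> u \<in> set C \<Longrightarrow> u \<in> set D \<Longrightarrow> C = D"
  using disjoint unfolding disjoint_cycles_def by (metis disjoint_iff)

lemma cls_cycle: "C \<in> \<C> \<Longrightarrow> u \<in> set C \<Longrightarrow> cls u = set C"
  using cycles_disjointD by (force simp: cycle_class_def)

lemma cls_singleton: "u \<notin> O\<C> \<Longrightarrow> cls u = {u}"
  by (auto simp: cycle_class_def)

lemma in_cls [simp]: "u \<in> cls u"
  by (simp add: cycle_class_def)

lemma O_subset: "O\<C> \<subseteq> V"
  using cycle_in rel_cycle_subset_verts by auto

lemma finite_O [simp]: "finite O\<C>"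
  by simp

lemma card_O: "card O\<C> = (\<Sum>C\<in>\<C>. length C)"
proof -
  have "card O\<C> = (\<Sum>C\<in>\<C>. card (set C))"
    by (rule card_UN_disjoint) (use disjoint in \<open>auto simp: disjoint_cycles_def\<close>)
  also have "\<dots> = (\<Sum>C\<in>\<C>. length C)"
    by (rule sum.cong[OF refl]) (use cycle_in distinct_card in \<open>auto simp: rel_cycle_def\<close>)
  finally show ?thesis .
qed

lemma cls_image_eq: "cls ` V = (\<lambda>u. {u}) ` (V - O\<C>) \<union> set ` \<C>"
proof
  show "cls ` V \<subseteq> (\<lambda>u. {u}) ` (V - O\<C>) \<union> set ` \<C>"
  proof
    fix X assume "X \<in> cls ` V"
    then obtain u where u: "u \<in> V" "X = cls u" by auto
    show "X \<in> (\<lambda>u. {u}) ` (V - O\<C>) \<union> set ` \<C>"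
    proof (cases "u \<in> O\<C>")
      case True
      then obtain C where "C \<in> \<C>" "u \<in> set C" by auto
      then show ?thesis using cls_cycle u by auto
    next
      case False
      then show ?thesis using cls_singleton u by auto
    qed
  qed
  have "set C \<in> cls ` V" if C: "C \<in> \<C>" for C
  proof -
    obtain u where u: "u \<in> set C" using cycle_nonempty[OF C] by blast
    then have "u \<in> V" using O_subset C by auto
    then show ?thesis using cls_cycle[OF C u] by (metis imageI)
  qed
  moreover have "{u} \<in> cls ` V" if "u \<in> V - O\<C>" for u
    using that cls_singleton[of u] by (metis DiffD1 DiffD2 imageI)
  ultimately show "(\<lambda>u. {u}) ` (V - O\<C>) \<union> set ` \<C> \<subseteq> cls ` V" by auto
qed

lemma card_cls: "card (cls ` V) + card O\<C> = card V + card \<C>"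
proof -
  have i1: "inj_on (\<lambda>u. {u}) (V - O\<C>)" by simp
  have i2: "inj_on set \<C>"
  proof (rule inj_onI)
    fix C D assume CD: "C \<in> \<C>" "D \<in> \<C>" "set C = set D"
    obtain u where "u \<in> set C" using cycle_nonempty[OF CD(1)] by blast
    then show "C = D" using cycles_disjointD[OF CD(1,2)] CD(3) by simp
  qed
  have "(\<lambda>u. {u}) ` (V - O\<C>) \<inter> set ` \<C> = {}" by auto
  then have "card (cls ` V) = card (V - O\<C>) + card \<C>"
    unfolding cls_image_eq by (subst card_Un_disjoint) (auto simp: card_image i1 i2)
  moreover have "card (V - O\<C>) + card O\<C> = card V"
    using card_Diff_subset[OF finite_O O_subset] card_mono[OF finite_verts O_subset] by simp
  ultimately show ?thesis by simp
qed

sublocale T: finite_symmetric_relation "cls ` V" T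
proof unfold_locales
  show "T \<subseteq> cls ` V \<times> cls ` V" using rel_in_verts by (auto simp: contracted_rel_def)
  show "(Y, X) \<in> T" if "(X, Y) \<in> T" for X Y
    using that by (elim contracted_relE) (metis contracted_relI rel_sym)
qed (auto simp: contracted_rel_def)

lemma T_connected: "connected_rel (cls ` V) T"
proof -
  have "(cls u, cls v) \<in> T\<^sup>*" if "(u, v) \<in> R\<^sup>*" for u v
    using that
  proof (induction rule: rtrancl_induct)
    case (step v w)
    have "cls v = cls w \<or> (cls v, cls w) \<in> T" using contracted_relI[OF step(2)] by blast
    then show ?case using step(3) by (metis rtrancl.rtrancl_into_rtrancl)
  qed simp
  then show ?thesis using connected by (auto simp: connected_rel_def)
qed

definition cycle_rel :: "'a rel" where
  "cycle_rel = (\<Union>C\<in>\<C>. cyclic_arcs C \<union> (cyclic_arcs C)\<inverse>)"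

lemma card_cycle_rel: "card cycle_rel = 2 * card O\<C>"
proof -
  have "card cycle_rel = (\<Sum>C\<in>\<C>. card (cyclic_arcs C \<union> (cyclic_arcs C)\<inverse>))"
    unfolding cycle_rel_def
  proof (rule card_UN_disjoint)
    show "\<forall>C\<in>\<C>. \<forall>D\<in>\<C>. C \<noteq> D \<longrightarrow>
      (cyclic_arcs C \<union> (cyclic_arcs C)\<inverse>) \<inter> (cyclic_arcs D \<union> (cyclic_arcs D)\<inverse>) = {}"
    proof (intro ballI impI equals0I)
      fix C D e assume CD: "C \<in> \<C>" "D \<in> \<C>" "C \<noteq> D"
        and "e \<in> (cyclic_arcs C \<union> (cyclic_arcs C)\<inverse>) \<inter> (cyclic_arcs D \<union> (cyclic_arcs D)\<inverse>)"
      then have "fst e \<in> set C" "fst e \<in> set D"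
        by (cases e; auto dest: cyclic_arcs_in_set)+
      then show False using cycles_disjointD CD by blast
    qed
  qed (auto intro: finite_converse)
  also have "\<dots> = (\<Sum>C\<in>\<C>. 2 * length C)"
  proof (rule sum.cong[OF refl])
    fix C assume C: "C \<in> \<C>"
    have "cyclic_arcs C \<inter> (cyclic_arcs C)\<inverse> = {}"
      using rel_cycle_arc_reverse_notin[OF cycle_in[OF C]] by auto
    moreover have "card (cyclic_arcs C) = length C"
      using card_cyclic_arcs cycle_in[OF C] by (auto simp: rel_cycle_def)
    ultimately show "card (cyclic_arcs C \<union> (cyclic_arcs C)\<inverse>) = 2 * length C"
      by (subst card_Un_disjoint) (auto simp: card_inverse)
  qed
  finally show ?thesis by (simp add: card_O sum_distrib_left)
qed

text \<open>
  Counting arcs: the contracted relation is connected on \<open>card V - card O\<C> + card \<C>\<close> vertices,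
  which leaves no room for chords of the cycles nor for cycles of the contracted relation.
\<close>

lemma inner_rel_eq_cycle_rel: "inner_rel \<C> R = cycle_rel"
  and card_T: "card T + 2 \<le> 2 * card (cls ` V)"
proof -
  have fin: "finite (inner_rel \<C> R)" by (auto intro: finite_subset[OF _ finite_rel] simp: inner_rel_def)
  have sub: "cycle_rel \<subseteq> inner_rel \<C> R"
  proof
    fix e assume "e \<in> cycle_rel"
    then obtain C where C: "C \<in> \<C>" "e \<in> cyclic_arcs C \<union> (cyclic_arcs C)\<inverse>" by (auto simp: cycle_rel_def)
    obtain u v where e: "e = (u, v)" by (cases e)
    have "(u, v) \<in> R" using C cycle_in[OF C(1)] rel_sym by (auto simp: e rel_cycle_def)
    moreover have "u \<in> set C" "v \<in> set C" using C(2) by (auto simp: e dest: cyclic_arcs_in_set)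
    ultimately show "e \<in> inner_rel \<C> R" using cls_cycle[OF C(1)] by (simp add: e inner_rel_def)
  qed
  have "T = (\<lambda>(u, v). (cls u, cls v)) ` (R - inner_rel \<C> R)"
    by (auto simp: contracted_rel_def inner_rel_def image_iff)
  then have "card T \<le> card (R - inner_rel \<C> R)" by (simp add: card_image_le)
  also have "\<dots> + card (inner_rel \<C> R) = card R"
  proof -
    have "inner_rel \<C> R \<subseteq> R" by (auto simp: inner_rel_def)
    then show ?thesis
      using card_Diff_subset[OF fin, of R] card_mono[OF finite_rel, of "inner_rel \<C> R"] by simp
  qed
  finally have T: "card T + card (inner_rel \<C> R) \<le> card R" by simp
  have cT: "2 * card (cls ` V) \<le> card T + 2" using T.connected_card_rel_ge[OF T_connected] nonempty by simp
  \<comment> \<open>What remains of \<open>card R\<close> after a spanning tree of the contraction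
    is exactly \<open>2 * card O\<C>\<close>, already used up by the cycle arcs.\<close>
  have "card (inner_rel \<C> R) \<le> card cycle_rel"
    using T cT card_rel card_cls card_cycle_rel by linarith
  then show eq: "inner_rel \<C> R = cycle_rel" using card_seteq[OF fin sub] by simp
  show "card T + 2 \<le> 2 * card (cls ` V)"
    using T card_rel card_cls card_cycle_rel unfolding eq by linarith
qed

text \<open>This makes the principal block of a cycle the matrix of the bare cycle, with two nonzero
  entries per row.\<close>

lemma cycle_chordless:
  assumes "C \<in> \<C>" "(u, v) \<in> R" "u \<in> set C" "v \<in> set C"
  shows "{u, v} \<in> cyclic_edges C"
proof -
  have "(u, v) \<in> cycle_rel"
    unfolding inner_rel_eq_cycle_rel[symmetric] using assms cls_cycle by (simp add: inner_rel_def)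
  then obtain D where D: "D \<in> \<C>" "(u, v) \<in> cyclic_arcs D \<or> (v, u) \<in> cyclic_arcs D"
    by (auto simp: cycle_rel_def)
  then have "u \<in> set D" by (auto dest: cyclic_arcs_in_set)
  then have "D = C" using cycles_disjointD D assms by blast
  then show ?thesis using D(2) by (auto simp: cyclic_edges_def insert_commute image_iff)
qed

lemma T_degenerate: "degenerate_rel (cls ` V) T"
  using T.tree_degenerate[OF T_connected card_T] .

lemma all_cycles: "rel_cycle R us \<Longrightarrow> \<exists>C\<in>\<C>. cyclic_edges us = cyclic_edges C"
  using disjoint_cycles_exhaust[OF connected nonempty disjoint card_rel] .

lemma cycle_same_vertices:
  assumes "rel_cycle R us"
  obtains C where "C \<in> \<C>" "set us = set C" "cyclic_edges us = cyclic_edges C"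
proof -
  from all_cycles[OF assms] obtain C where C: "C \<in> \<C>" "cyclic_edges us = cyclic_edges C" by blast
  then have "set us = set C" using Union_cyclic_edges by metis
  then show thesis using that C by blast
qed

section \<open>Matching numbers under contraction\<close>

abbreviation "RO \<equiv> R \<inter> (V - O\<C>) \<times> (V - O\<C>)"

sublocale RO: finite_symmetric_relation "V - O\<C>" RO
  by (rule restrict) auto

lemma RO_matching_number_le: "rel_matching_number RO \<le> rel_matching_number T"
proof -
  obtain M where M: "rel_matching RO M" "card M = rel_matching_number RO"
    using RO.rel_matching_number_attained .
  have single: "cls ` e = (\<lambda>w. {w}) ` e" if "e \<in> M" for e
  proof -
    have "e \<subseteq> V - O\<C>" using RO.rel_matching_subset_verts[OF M(1)] that by blast
    then show ?thesis by (intro image_cong[OF refl] cls_singleton) auto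
  qed
  have Un: "\<Union>(cls ` e) = e" if "e \<in> M" for e
    unfolding single[OF that] by auto
  then have inj: "inj_on ((`) cls) M" by (metis inj_onI)
  have "rel_matching T ((`) cls ` M)"
    unfolding rel_matching_def
  proof (intro conjI subsetI ballI impI)
    fix X assume "X \<in> (`) cls ` M"
    then obtain e where e: "e \<in> M" "X = cls ` e" by auto
    obtain u v where uv: "e = {u, v}" "(u, v) \<in> RO" "u \<noteq> v" by (rule RO.rel_matching_edge[OF M(1) e(1)])
    then have "cls u = {u}" "cls v = {v}" by (auto intro!: cls_singleton)
    then have "(cls u, cls v) \<in> T" using uv by (intro contracted_relI) auto
    then show "X \<in> (\<lambda>(u, v). {u, v}) ` T"
      using e(2) uv(1) by (intro image_eqI[of _ _ "(cls u, cls v)"]) auto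
  next
    fix X Y assume "X \<in> (`) cls ` M" "Y \<in> (`) cls ` M" "X \<noteq> Y"
    then obtain e f where ef: "e \<in> M" "f \<in> M" "X = cls ` e" "Y = cls ` f" "e \<noteq> f" by auto
    then have "e \<inter> f = {}" using M(1) by (simp add: rel_matching_def)
    then show "X \<inter> Y = {}" unfolding ef(3,4) single[OF ef(1)] single[OF ef(2)] by auto
  qed
  from T.rel_matching_number_ge[OF this] show ?thesis using M(2) card_image[OF inj] by simp
qed

end

section \<open>Odd cycles: lifting matchings and covers from the contraction\<close>

locale maximal_disjoint_odd_cycles = maximal_disjoint_cycles +
  assumes odd_cycles: "C \<in> \<C> \<Longrightarrow> odd (length C)"
begin

text \<open>Each matching edge of the contraction lifts to an arc between its two classes. A
  contracted cycle lies on at most one matching edge, so the lift uses at most one vertex of that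
  cycle, and the odd cycle can be completed.\<close>

lemma T_matching_number_lift: "2 * rel_matching_number T + card O\<C> \<le> 2 * rel_matching_number R + card \<C>"
proof -
  obtain N where N: "rel_matching T N" "card N = rel_matching_number T"
    using T.rel_matching_number_attained .
  have "\<exists>p. (\<exists>u v. p = {u, v} \<and> (u, v) \<in> R \<and> cls u \<noteq> cls v) \<and> e = cls ` p" if "e \<in> N" for e
  proof -
    obtain X Y where "e = {X, Y}" "(X, Y) \<in> T" "X \<noteq> Y" by (rule T.rel_matching_edge[OF N(1) \<open>e \<in> N\<close>])
    then obtain u v where "e = cls ` {u, v}" "(u, v) \<in> R" "cls u \<noteq> cls v"
      by (elim contracted_relE) auto
    then show ?thesis by (intro exI[of _ "{u, v}"]) auto
  qed
  then obtain f where f: "\<And>e. e \<in> N \<Longrightarrow> \<exists>u v. f e = {u, v} \<and> (u, v) \<in> R \<and> cls u \<noteq> cls v"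
    "\<And>e. e \<in> N \<Longrightarrow> e = cls ` f e" by metis
  have inj: "inj_on f N" by (metis f(2) inj_onI)
  have same: "e = e'" if "e \<in> N" "e' \<in> N" "w \<in> f e" "w' \<in> f e'" "cls w = cls w'" for e e' w w'
  proof (rule ccontr)
    assume "e \<noteq> e'"
    then have "e \<inter> e' = {}" using N(1) that by (simp add: rel_matching_def)
    moreover have "cls w \<in> cls ` f e" "cls w \<in> cls ` f e'" using that by auto
    ultimately show False using f(2)[OF that(1)] f(2)[OF that(2)] by auto
  qed
  have "rel_matching R (f ` N)"
    unfolding rel_matching_def
  proof (intro conjI subsetI ballI impI)
    fix x assume "x \<in> f ` N"
    then obtain e where "e \<in> N" "x = f e" by auto
    then obtain u v where "x = {u, v}" "(u, v) \<in> R" using f(1) by metis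
    then show "x \<in> (\<lambda>(u, v). {u, v}) ` R" by (intro image_eqI[of _ _ "(u, v)"]) auto
  next
    fix x y assume "x \<in> f ` N" "y \<in> f ` N" "x \<noteq> y"
    then show "x \<inter> y = {}" using same by (auto simp: disjoint_iff)
  qed
  moreover have "\<exists>v\<in>set C. \<Union>(f ` N) \<inter> set C \<subseteq> {v}" if C: "C \<in> \<C>" for C
  proof -
    have eq: "w = w'" if w: "w \<in> \<Union>(f ` N) \<inter> set C" "w' \<in> \<Union>(f ` N) \<inter> set C" for w w'
    proof -
      from w obtain e e' where e: "e \<in> N" "e' \<in> N" "w \<in> f e" "w' \<in> f e'" by auto
      have c: "cls w = cls w'" using w cls_cycle[OF C] by simp
      then have "e = e'" using same e by blast
      then show ?thesis using f(1)[OF e(1)] e c by auto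
    qed
    show ?thesis
    proof (cases "\<Union>(f ` N) \<inter> set C = {}")
      case True
      moreover obtain v where "v \<in> set C" using cycle_nonempty[OF C] by blast
      ultimately show ?thesis by auto
    next
      case False
      then obtain w where "w \<in> \<Union>(f ` N) \<inter> set C" by auto
      then show ?thesis using eq by (intro bexI[of _ w]) auto
    qed
  qed
  ultimately obtain M where M: "rel_matching R M"
    "2 * card M + card \<C> = 2 * card (f ` N) + (\<Sum>C\<in>\<C>. length C)"
    using extend_matching_by_odd_cycles[OF _ disjoint odd_cycles, of "f ` N"] by auto
  then show ?thesis using rel_matching_number_ge[OF M(1)] N(2) card_image[OF inj] card_O by simp
qed

text \<open>
  A minimum vertex cover of the contracted tree meets every edge of a maximum matching in exactly
  one vertex; if that matching can be chosen to avoid the contracted vertices, so does the cover.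
\<close>

lemma cover_off_cycles:
  assumes "rel_matching_number T = rel_matching_number RO"
  obtains K p where "K \<subseteq> V - O\<C>" "card K = rel_matching_number T" "inj_on p K" "p ` K \<subseteq> V - O\<C>"
    "p ` K \<inter> K = {}" "\<And>k. k \<in> K \<Longrightarrow> (k, p k) \<in> R"
    "\<And>u v. (u, v) \<in> R \<Longrightarrow> cls u \<noteq> cls v \<Longrightarrow> u \<in> K \<or> v \<in> K"
proof -
  obtain KT MT where KT: "KT \<subseteq> cls ` V" "vertex_cover T KT" "rel_matching T MT" "card MT = card KT"
    using T.koenig_degenerate[OF T_degenerate] by auto
  have finKT: "finite KT" by (rule finite_subset[OF KT(1)]) simp
  have cKT: "card KT = rel_matching_number T"
  proof (rule antisym)
    show "card KT \<le> rel_matching_number T" using T.rel_matching_number_ge[OF KT(3)] KT(4) by simp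
    obtain N where N: "rel_matching T N" "card N = rel_matching_number T" using T.rel_matching_number_attained .
    then show "rel_matching_number T \<le> card KT" using matching_le_cover[OF N(1) KT(2) finKT] by simp
  qed
  obtain M where M: "rel_matching RO M" "card M = rel_matching_number RO"
    using RO.rel_matching_number_attained .
  define K where "K = {u \<in> V - O\<C>. {u} \<in> KT}"
  have K: "K \<subseteq> V - O\<C>" by (auto simp: K_def)
  have finK: "finite K" by (simp add: K_def)
  have coverRO: "vertex_cover RO K"
    unfolding vertex_cover_def
  proof safe
    fix u v assume uv: "(u, v) \<in> R" "u \<in> V" "v \<in> V" "u \<notin> O\<C>" "v \<notin> O\<C>" "v \<notin> K"
    have c: "cls u = {u}" "cls v = {v}" using uv cls_singleton by auto
    have "u \<noteq> v" using uv(1) rel_irrefl by blast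
    then have "({u}, {v}) \<in> T" using contracted_relI[OF uv(1), of \<C>] c by simp
    then have "{u} \<in> KT \<or> {v} \<in> KT" by (rule vertex_coverD[OF KT(2)])
    then show "u \<in> K" using uv by (auto simp: K_def)
  qed
  have le: "card K \<le> card KT"
    by (rule card_inj_on_le[of "\<lambda>u. {u}"]) (use finKT in \<open>auto simp: K_def\<close>)
  have "card M \<le> card K" by (rule matching_le_cover[OF M(1) coverRO finK])
  \<comment> \<open>The chain \<open>card M \<le> card K \<le> card KT\<close> closes up, since both
    ends are the common matching number.\<close>
  then have cK: "card K = card M" "card K = card KT" using le M(2) cKT assms by auto
  have "(\<lambda>u. {u}) ` K \<subseteq> KT" by (auto simp: K_def)
  moreover have "card ((\<lambda>u. {u}) ` K) = card KT" using cK(2) by (simp add: card_image)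
  \<comment> \<open>Hence \<open>KT\<close> consists of singletons of vertices off the cycles and
    contains no contracted cycle.\<close>
  ultimately have KT_eq: "(\<lambda>u. {u}) ` K = KT" by (rule card_subset_eq[OF finKT])
  obtain g where g: "inj_on g M" "\<And>e. e \<in> M \<Longrightarrow> g e \<in> e" "\<And>e. e \<in> M \<Longrightarrow> g e \<in> K"
    using matching_into_cover[OF M(1) coverRO] by metis
  have gM: "g ` M = K"
    by (rule card_subset_eq[OF finK]) (use g cK in \<open>auto simp: card_image\<close>)
  \<comment> \<open>Each cover vertex \<open>k\<close> lies on its own matching edge
    \<open>f k\<close>, whose other end becomes \<open>p k\<close>. That end is not in
    \<open>K\<close>, as two cover vertices never share a matching edge.\<close>
  define f where "f = inv_into M g"
  have f: "f k \<in> M" "g (f k) = k" if "k \<in> K" for k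
    using that unfolding f_def gM[symmetric] by (auto intro: inv_into_into f_inv_into_f)
  have "\<exists>l. f k = {k, l} \<and> (k, l) \<in> RO" if k: "k \<in> K" for k
  proof -
    obtain u v where uv: "f k = {u, v}" "(u, v) \<in> RO" "u \<noteq> v"
      by (rule RO.rel_matching_edge[OF M(1) f(1)[OF k]])
    then have "(v, u) \<in> RO" using RO.rel_sym by blast
    then show ?thesis using uv g(2)[OF f(1)[OF k]] f(2)[OF k] by (auto simp: insert_commute)
  qed
  then obtain p where p: "\<And>k. k \<in> K \<Longrightarrow> f k = {k, p k}" "\<And>k. k \<in> K \<Longrightarrow> (k, p k) \<in> RO" by metis
  note pf = f p
  have same: "e = e'" if "e \<in> M" "e' \<in> M" "w \<in> e" "w \<in> e'" for e e' w
    using that M(1) unfolding rel_matching_def by (metis disjoint_iff)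
  show thesis
  proof (rule that[OF K])
    show "card K = rel_matching_number T" using cK cKT by simp
    show "inj_on p K"
    proof (rule inj_onI)
      fix k k' assume k: "k \<in> K" "k' \<in> K" "p k = p k'"
      then have "f k = f k'" using same[OF pf(1)[OF k(1)] pf(1)[OF k(2)], of "p k"] pf(3) by simp
      then show "k = k'" using pf(2) k by metis
    qed
    show "p ` K \<subseteq> V - O\<C>" using pf(4) by auto
    show "p ` K \<inter> K = {}"
    proof (rule equals0I)
      fix l assume "l \<in> p ` K \<inter> K"
      then obtain k where k: "k \<in> K" "l = p k" "l \<in> K" by auto
      then have "f k = f l" using same[OF pf(1)[OF k(1)] pf(1)[OF k(3)], of l] pf(3) by simp
      then have "k = l" using pf(2) k by metis
      then show False using pf(4)[OF k(1)] k(2) rel_irrefl by auto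
    qed
    show "(k, p k) \<in> R" if "k \<in> K" for k using pf(4)[OF that] by simp
    show "u \<in> K \<or> v \<in> K" if uv: "(u, v) \<in> R" "cls u \<noteq> cls v" for u v
    proof -
      have "(cls u, cls v) \<in> T" by (rule contracted_relI[OF uv])
      then have "cls u \<in> KT \<or> cls v \<in> KT" by (rule vertex_coverD[OF KT(2)])
      moreover have "w \<in> K" if "cls w \<in> KT" for w
      proof -
        obtain w' where "w' \<in> K" "cls w = {w'}" using \<open>cls w \<in> KT\<close> unfolding KT_eq[symmetric] by auto
        then show ?thesis using in_cls[of w] by simp
      qed
      ultimately show ?thesis by blast
    qed
  qed
qed

lemma cls_eq_imp_same_cycle:
  assumes "cls u = cls v" "u \<noteq> v" obtains C where "C \<in> \<C>" "u \<in> set C" "v \<in> set C"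
proof -
  have "u \<in> O\<C>" using assms in_cls[of v] cls_singleton[of u] by force
  then obtain C where C: "C \<in> \<C>" "u \<in> set C" by blast
  have "v \<in> set C" using in_cls[of v] unfolding assms(1)[symmetric] cls_cycle[OF C] .
  then show thesis using C that by blast
qed

text \<open>A matching edge meets \<open>K\<close> or lies inside one odd cycle of length
  \<open>l\<close>, which has room for \<open>(l - 1) / 2\<close> edges. With
  \<open>T_matching_number_lift\<close> this determines \<open>2 * m + c\<close> when
  \<open>card K\<close> is the matching number of \<open>T\<close>.\<close>

lemma matching_number_le_cover:
  assumes K: "finite K" "\<And>u v. (u, v) \<in> R \<Longrightarrow> cls u \<noteq> cls v \<Longrightarrow> u \<in> K \<or> v \<in> K"
  shows "2 * rel_matching_number R + card \<C> \<le> 2 * card K + card O\<C>"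
proof -
  obtain M where M: "rel_matching R M" "card M = rel_matching_number R"
    using rel_matching_number_attained .
  have finM: "finite M" by (rule rel_matching_finite[OF M(1)])
  define MK where "MK = {e\<in>M. e \<inter> K \<noteq> {}}"
  define MC where "MC C = {e\<in>M. e \<subseteq> set C}" for C
  have "M \<subseteq> MK \<union> (\<Union>C\<in>\<C>. MC C)"
  proof
    fix e assume e: "e \<in> M"
    obtain u v where uv: "e = {u, v}" "(u, v) \<in> R" "u \<noteq> v" by (rule rel_matching_edge[OF M(1) e])
    show "e \<in> MK \<union> (\<Union>C\<in>\<C>. MC C)"
    proof (cases "cls u = cls v")
      case True
      then obtain C where "C \<in> \<C>" "u \<in> set C" "v \<in> set C" using cls_eq_imp_same_cycle uv by metis
      then show ?thesis using e uv by (auto simp: MC_def)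
    next
      case False
      then show ?thesis using K(2)[OF uv(2)] e uv by (auto simp: MK_def)
    qed
  qed
  then have "card M \<le> card (MK \<union> (\<Union>C\<in>\<C>. MC C))"
    using finM by (intro card_mono) (auto simp: MK_def MC_def)
  also have "\<dots> \<le> card MK + card (\<Union>C\<in>\<C>. MC C)" by (rule card_Un_le)
  also have "card (\<Union>C\<in>\<C>. MC C) \<le> (\<Sum>C\<in>\<C>. card (MC C))" by (rule card_UN_le) simp
  finally have 1: "card M \<le> card MK + (\<Sum>C\<in>\<C>. card (MC C))" by simp
  have 2: "card MK \<le> card K"
  proof -
    have "rel_matching (R \<inter> {(u, v). u \<in> K \<or> v \<in> K}) MK"
      unfolding rel_matching_def
    proof (intro conjI subsetI)
      fix e assume "e \<in> MK"
      then have e: "e \<in> M" "e \<inter> K \<noteq> {}" by (auto simp: MK_def)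
      obtain u v where uv: "e = {u, v}" "(u, v) \<in> R" "u \<noteq> v" by (rule rel_matching_edge[OF M(1) e(1)])
      then have "(u, v) \<in> R \<inter> {(u, v). u \<in> K \<or> v \<in> K}" using e(2) by auto
      then show "e \<in> (\<lambda>(u, v). {u, v}) ` (R \<inter> {(u, v). u \<in> K \<or> v \<in> K})"
        using uv(1) by (intro image_eqI[of _ _ "(u, v)"]) auto
    qed (use M(1) in \<open>auto simp: MK_def rel_matching_def\<close>)
    then show ?thesis by (rule matching_le_cover) (use K(1) in \<open>auto simp: vertex_cover_def\<close>)
  qed
  have 3: "2 * card (MC C) + 1 \<le> length C" if C: "C \<in> \<C>" for C
  proof -
    have "rel_matching R (MC C)" by (rule rel_matching_subset[OF M(1)]) (auto simp: MC_def)
    then have "2 * card (MC C) = card (\<Union>(MC C))" by (simp add: card_Union_rel_matching)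
    also have "\<dots> \<le> card (set C)" by (rule card_mono) (auto simp: MC_def)
    also have "\<dots> \<le> length C" by (rule card_length)
    finally have "2 * card (MC C) \<le> length C" .
    moreover have "2 * card (MC C) \<noteq> length C" using odd_cycles[OF C] by (metis dvd_triv_left)
    ultimately show ?thesis by linarith
  qed
  have "(\<Sum>C\<in>\<C>. 2 * card (MC C) + 1) \<le> (\<Sum>C\<in>\<C>. length C)" by (rule sum_mono) (rule 3)
  then have "2 * (\<Sum>C\<in>\<C>. card (MC C)) + card \<C> \<le> card O\<C>"
    by (simp add: sum.distrib sum_distrib_left card_O sum_Suc)
  then show ?thesis using 1 2 M(2) by linarith
qed

end

section \<open>Existence of a maximal family of disjoint cycles\<close>

text \<open>With one representative for every cycle, deleting one edge from each representative
  leaves a forest; this bounds \<open>card R\<close> from above, matching the bound from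
  \<open>disjoint_cycles_le_cyclomatic\<close>.\<close>

lemma (in finite_symmetric_relation) disjoint_cycles_imp_maximal_family:
  assumes conn: "connected_rel V R" and ne: "V \<noteq> {}"
    and disj: "\<And>us vs. rel_cycle R us \<Longrightarrow> rel_cycle R vs \<Longrightarrow> cyclic_edges us \<noteq> cyclic_edges vs
      \<Longrightarrow> set us \<inter> set vs = {}"
  shows "\<exists>\<C>. maximal_disjoint_cycles V R \<C>"
proof -
  let ?cyc = "{us. rel_cycle R us}"
  have "?cyc \<subseteq> {us. set us \<subseteq> V \<and> distinct us}"
    using rel_cycle_subset_verts by (auto simp: rel_cycle_def)
  then have fin: "finite ?cyc"
    using finite_subset_distinct[OF finite_verts] by (rule finite_subset)
  \<comment> \<open>Many lists describe the same cycle; one is chosen per edge set.\<close>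
  define rep where "rep = inv_into ?cyc cyclic_edges"
  define \<C> where "\<C> = rep ` cyclic_edges ` ?cyc"
  have rep: "rel_cycle R (rep E)" "cyclic_edges (rep E) = E" if "E \<in> cyclic_edges ` ?cyc" for E
    using inv_into_into[OF that] f_inv_into_f[OF that] by (auto simp: rep_def)
  have exhaust: "\<exists>C\<in>\<C>. cyclic_edges us = cyclic_edges C" if "rel_cycle R us" for us
    using that rep[of "cyclic_edges us"] by (auto simp: \<C>_def)
  have \<C>: "disjoint_cycles R \<C>"
    unfolding disjoint_cycles_def
  proof (intro conjI ballI impI)
    show "finite \<C>" using fin by (simp add: \<C>_def)
    show "rel_cycle R C" if "C \<in> \<C>" for C using that rep by (auto simp: \<C>_def)
  next
    fix C D assume CD: "C \<in> \<C>" "D \<in> \<C>" "C \<noteq> D"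
    then obtain E F where EF: "E \<in> cyclic_edges ` ?cyc" "F \<in> cyclic_edges ` ?cyc" "C = rep E" "D = rep F"
      by (auto simp: \<C>_def)
    then have "cyclic_edges C \<noteq> cyclic_edges D" using CD(3) rep by metis
    then show "set C \<inter> set D = {}" using disj EF rep by blast
  qed
  have fin\<C>: "finite \<C>" using \<C> by (simp add: disjoint_cycles_def)
  have "\<exists>e. e \<in> cyclic_arcs C" if "C \<in> \<C>" for C
  proof -
    have "3 \<le> card (cyclic_arcs C)"
      using that \<C> card_cyclic_arcs[of C] by (simp add: disjoint_cycles_def rel_cycle_def)
    then have "cyclic_arcs C \<noteq> {}" by (intro notI) simp
    then show ?thesis by blast
  qed
  then obtain a where a: "\<And>C. C \<in> \<C> \<Longrightarrow> a C \<in> cyclic_arcs C" by metis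
  define B where "B = (\<Union>C\<in>\<C>. {a C, prod.swap (a C)})"
  have swapB: "(u, v) \<in> B \<longleftrightarrow> (v, u) \<in> B" for u v by (auto simp: B_def prod_eq_iff)
  interpret R': finite_symmetric_relation V "R - B"
    using rel_subset rel_sym rel_irrefl swapB by unfold_locales auto
  have "\<nexists>us. rel_cycle (R - B) us"
  proof
    assume "\<exists>us. rel_cycle (R - B) us"
    then obtain us where us: "rel_cycle (R - B) us" by blast
    then have "rel_cycle R us" by (auto simp: rel_cycle_def)
    then obtain C where C: "C \<in> \<C>" "cyclic_edges us = cyclic_edges C" using exhaust by blast
    obtain u v where uv: "a C = (u, v)" by (cases "a C")
    have "(\<lambda>(u, v). {u, v}) (a C) \<in> cyclic_edges C" using a[OF C(1)] unfolding cyclic_edges_def by (rule imageI)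
    then have "{u, v} \<in> cyclic_edges us" using C(2) uv by simp
    then obtain e where e: "e \<in> cyclic_arcs us" "{u, v} = (\<lambda>(u, v). {u, v}) e"
      unfolding cyclic_edges_def by (rule imageE)
    then have "e = (u, v) \<or> e = (v, u)" by (cases e) (auto simp: doubleton_eq_iff)
    then have "e \<in> B" using C(1) uv by (force simp: B_def)
    then show False using e us by (auto simp: rel_cycle_def)
  qed
  then have 1: "card (R - B) + 2 \<le> 2 * card V" using R'.acyclic_card_rel[OF ne] by simp
  have "card B \<le> (\<Sum>C\<in>\<C>. card {a C, prod.swap (a C)})"
    unfolding B_def using fin\<C> by (rule card_UN_le)
  also have "\<dots> \<le> (\<Sum>C\<in>\<C>. 2)" by (intro sum_mono) (simp add: card_insert_if)
  finally have 2: "card B \<le> 2 * card \<C>" by simp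
  have "finite B" using fin\<C> by (simp add: B_def)
  then have "card R \<le> card (R - B) + card B"
    using card_Un_le[of "R - B" B] card_mono[of "R - B \<union> B" R] by auto
  then have "card R + 2 = 2 * card V + 2 * card \<C>"
    using 1 2 disjoint_cycles_le_cyclomatic[OF conn ne \<C>] by linarith
  then show ?thesis
    using conn ne \<C> by (intro exI[of _ \<C>]) unfold_locales
qed

section \<open>The gain matrix of an odd cycle\<close>

text \<open>Matrix entries indexed by vertices instead of positions, so that kernels can be studied
  on arbitrary vertex sets.\<close>

definition gain_weight :: "'a rel \<Rightarrow> ('a \<times> 'a \<Rightarrow> complex) \<Rightarrow> 'a \<Rightarrow> 'a \<Rightarrow> complex" where
  "gain_weight R \<phi> u v = (if (u, v) \<in> R then \<phi> (u, v) else 0)"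

locale unit_gain_relation = finite_symmetric_relation V R
  for V :: "'a set" and R :: "'a rel" +
  fixes \<phi> :: "'a \<times> 'a \<Rightarrow> complex"
  assumes unit: "e \<in> R \<Longrightarrow> cmod (\<phi> e) = 1"
    and inverse_gain: "(u, v) \<in> R \<Longrightarrow> \<phi> (u, v) = inverse (\<phi> (v, u))"
begin

abbreviation "h \<equiv> gain_weight R \<phi>"

lemma h_nonzero_iff: "h u v \<noteq> 0 \<longleftrightarrow> (u, v) \<in> R"
  using unit[of "(u, v)"] by (auto simp: gain_weight_def)

lemma h_zero: "(u, v) \<notin> R \<Longrightarrow> h u v = 0"
  by (simp add: gain_weight_def)

end

locale chordless_gain_cycle = unit_gain_relation +
  fixes us :: "'a list"
  assumes cycle: "rel_cycle R us"
    and chordless: "(u, v) \<in> R \<Longrightarrow> u \<in> set us \<Longrightarrow> v \<in> set us \<Longrightarrow> {u, v} \<in> cyclic_edges us"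
    and odd_length: "odd (length us)"
begin

abbreviation "l \<equiv> length us"

text \<open>Indices are unrolled periodically, so that no case distinction is needed at the ends.\<close>

definition vert :: "nat \<Rightarrow> 'a" where "vert j = us ! (j mod l)"
definition gain :: "nat \<Rightarrow> complex" where "gain j = \<phi> (vert j, vert (Suc j))"
definition pgain :: "nat \<Rightarrow> complex" where "pgain j = (\<Prod>i<j. gain i)"

lemma length_ge: "3 \<le> l" and distinct_us: "distinct us"
  using cycle by (auto simp: rel_cycle_def)

lemma length_pos: "0 < l" using length_ge by linarith

lemma vert_add_length [simp]: "vert (j + l) = vert j"
  by (simp add: vert_def)

lemma gain_add_length [simp]: "gain (j + l) = gain j"
  using vert_add_length[of "Suc j"] by (simp add: gain_def)

lemma set_us: "set us = range vert"
proof
  show "set us \<subseteq> range vert"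
  proof
    fix u assume "u \<in> set us"
    then obtain i where "i < l" "us ! i = u" by (auto simp: in_set_conv_nth)
    then have "u = vert i" by (simp add: vert_def)
    then show "u \<in> range vert" by simp
  qed
  show "range vert \<subseteq> set us" using length_pos by (auto simp: vert_def)
qed

lemma vert_eq_iff: "vert i = vert j \<longleftrightarrow> i mod l = j mod l"
  unfolding vert_def using distinct_us length_pos by (simp add: nth_eq_iff_index_eq)

lemma cyclic_arcs_vert: "cyclic_arcs us = {(vert j, vert (Suc j)) |j. True}"
proof -
  have "(vert j, vert (Suc j)) \<in> cyclic_arcs us" for j
    unfolding cyclic_arcs_conv_nth vert_def using length_pos
    by (intro CollectI exI[of _ "j mod l"]) (simp add: mod_Suc_eq)
  moreover have "\<exists>j. (a, b) = (vert j, vert (Suc j))" if "(a, b) \<in> cyclic_arcs us" for a b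
    using that unfolding cyclic_arcs_conv_nth vert_def by force
  ultimately show ?thesis by auto
qed

lemma arc: "(vert j, vert (Suc j)) \<in> R"
  using cycle cyclic_arcs_vert by (auto simp: rel_cycle_def)

lemma neighbour_in_cycle:
  assumes "(vert (Suc j), v) \<in> R" "v \<in> set us" shows "v = vert (Suc (Suc j)) \<or> v = vert j"
proof -
  have "{vert (Suc j), v} \<in> cyclic_edges us" using assms chordless set_us by blast
  then obtain e where e: "e \<in> cyclic_arcs us" "{vert (Suc j), v} = (\<lambda>(u, v). {u, v}) e"
    unfolding cyclic_edges_def by (rule imageE)
  then obtain i where i: "{vert (Suc j), v} = {vert i, vert (Suc i)}"
    unfolding cyclic_arcs_vert by auto
  have S: "Suc m mod l = Suc n mod l \<longleftrightarrow> m mod l = n mod l" for m n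
    using length_pos by (auto simp: mod_Suc)
  from i consider "vert (Suc j) = vert i" "v = vert (Suc i)" | "vert (Suc j) = vert (Suc i)" "v = vert i"
    by (auto simp: doubleton_eq_iff)
  then show ?thesis by cases (auto simp: vert_eq_iff S)
qed

text \<open>The row is taken at \<open>Suc j\<close> so that its predecessor is \<open>j\<close>,
  without subtraction. The inverse belongs to the arc traversed backwards; the two neighbours differ
  because the length is at least 3.\<close>

lemma row_sum:
  "(\<Sum>v\<in>set us. h (vert (Suc j)) v * x v)
    = gain (Suc j) * x (vert (Suc (Suc j))) + inverse (gain j) * x (vert j)"
proof -
  have ne: "vert (Suc (Suc j)) \<noteq> vert j"
    using length_ge by (auto simp: vert_eq_iff mod_Suc)
  have "(\<Sum>v\<in>set us. h (vert (Suc j)) v * x v)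
      = (\<Sum>v\<in>{vert (Suc (Suc j)), vert j}. h (vert (Suc j)) v * x v)"
  proof (rule sum.mono_neutral_right)
    show "\<forall>v\<in>set us - {vert (Suc (Suc j)), vert j}. h (vert (Suc j)) v * x v = 0"
      using neighbour_in_cycle h_zero by fastforce
    show "{vert (Suc (Suc j)), vert j} \<subseteq> set us" unfolding set_us by blast
  qed simp
  also have "\<dots> = h (vert (Suc j)) (vert (Suc (Suc j))) * x (vert (Suc (Suc j))) + h (vert (Suc j)) (vert j) * x (vert j)"
    using ne by simp
  finally show ?thesis
    using arc[of "Suc j"] arc[of j] rel_sym[OF arc[of j]] inverse_gain[OF rel_sym[OF arc[of j]]]
    by (simp add: gain_weight_def gain_def)
qed

lemma gain_nonzero [simp]: "gain j \<noteq> 0"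
  using unit[OF arc[of j]] by (auto simp: gain_def)

lemma pgain_Suc: "pgain (Suc j) = pgain j * gain j"
  by (simp add: pgain_def)

lemma pgain_nonzero [simp]: "pgain j \<noteq> 0"
  by (simp add: pgain_def)

lemma pgain_add_length: "pgain (j + l) = pgain l * pgain j"
  by (induction j) (simp_all add: pgain_Suc, simp add: pgain_def)

lemma pgain_length_unit: "cmod (pgain l) = 1"
  unfolding pgain_def prod_norm[symmetric] using unit[OF arc] by (simp add: gain_def)

text \<open>On the unit circle, the points with square -1 and those with real part 0 are both just
  plus and minus the imaginary unit.\<close>

lemma pgain_square_iff: "pgain l * pgain l = -1 \<longleftrightarrow> Re (pgain l) = 0"
proof -
  have n: "(Re (pgain l))\<^sup>2 + (Im (pgain l))\<^sup>2 = 1"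
    using pgain_length_unit by (simp add: cmod_def)
  show ?thesis
  proof
    assume "pgain l * pgain l = -1"
    then have "(Re (pgain l))\<^sup>2 - (Im (pgain l))\<^sup>2 = -1" by (simp add: complex_eq_iff power2_eq_square)
    then have "(Re (pgain l))\<^sup>2 = 0" using n by linarith
    then show "Re (pgain l) = 0" by simp
  next
    assume "Re (pgain l) = 0"
    then show "pgain l * pgain l = -1" using n by (simp add: complex_eq_iff power2_eq_square)
  qed
qed

text \<open>
  After rescaling by the partial gains, the kernel equations become \<open>z (j + 2) = - z j\<close> with the
  quasi-periodicity \<open>z (j + l) = \<gamma> z j\<close>, where \<open>\<gamma>\<close> is the gain of the cycle. Going around twice gives
  \<open>\<gamma>\<^sup>2 z = - z\<close>, and \<open>\<gamma>\<^sup>2 = -1\<close> says that \<open>Re \<gamma> = 0\<close>.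
\<close>

lemma trivial_kernel_cycle:
  assumes "Re (pgain l) \<noteq> 0" shows "trivial_kernel h (set us) (set us)"
  unfolding trivial_kernel_def
proof (intro allI impI ballI)
  fix x u assume x: "\<forall>i\<in>set us. (\<Sum>j\<in>set us. h i j * x j) = 0" and u: "u \<in> set us"
  define z where "z j = pgain j * x (vert j)" for j
  have step: "z (Suc (Suc j)) = - z j" for j
  proof -
    have "gain (Suc j) * x (vert (Suc (Suc j))) + inverse (gain j) * x (vert j) = 0"
      using x set_us row_sum[of j x] by auto
    then have "gain (Suc j) * x (vert (Suc (Suc j))) = - inverse (gain j) * x (vert j)"
      by (simp add: eq_neg_iff_add_eq_0)
    moreover have "z (Suc (Suc j)) = pgain j * gain j * (gain (Suc j) * x (vert (Suc (Suc j))))"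
      by (simp add: z_def pgain_Suc)
    ultimately show ?thesis by (simp add: z_def)
  qed
  have even_step: "z (j + 2 * k) = (-1) ^ k * z j" for j k
    by (induction k) (simp_all add: step)
  obtain j where j: "u = vert j" using u set_us by auto
  have period: "z (i + l) = pgain l * z i" for i by (simp add: z_def pgain_add_length)
  have "z (j + 2 * l) = pgain l * pgain l * z j"
    using period[of j] period[of "j + l"] by (simp add: add.assoc mult_2)
  moreover have "z (j + 2 * l) = - z j" using even_step[of j l] odd_length by simp
  ultimately have "(pgain l * pgain l + 1) * z j = 0" by (simp add: algebra_simps)
  moreover have "pgain l * pgain l + 1 \<noteq> 0" using assms pgain_square_iff by (simp add: add_eq_0_iff2)
  ultimately show "x u = 0" by (simp add: z_def j)
qed

lemma kernel_cycle:
  assumes "Re (pgain l) = 0"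
  shows "\<exists>x. (\<exists>u\<in>set us. x u \<noteq> 0) \<and> (\<forall>u\<in>set us. (\<Sum>v\<in>set us. h u v * x v) = 0)"
proof -
  have sq: "pgain l * pgain l = -1" using assms pgain_square_iff by simp
  obtain m where m: "l = 2 * m + 1" using odd_length by (rule oddE)
  \<comment> \<open>The solution is sought as \<open>\<omega> ^ j\<close> after rescaling: the
    recursion wants \<open>\<omega> * \<omega> = -1\<close>, the period wants
    \<open>\<omega> ^ l = pgain l\<close>. For \<open>l = 2 * m + 1\<close> the left side is
    \<open>(-1) ^ m * \<omega>\<close>, which dictates this value.\<close>
  define \<omega> where "\<omega> = (-1) ^ m * pgain l"
  have \<omega>2: "\<omega> * \<omega> = -1"
  proof -
    have "\<omega> * \<omega> = ((-1) ^ m * (-1) ^ m) * (pgain l * pgain l)" by (simp add: \<omega>_def)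
    then show ?thesis by (simp add: sq power_add[symmetric] mult_2[symmetric])
  qed
  have "\<omega> ^ l = (\<omega> * \<omega>) ^ m * \<omega>" unfolding m by (simp add: power_mult power2_eq_square)
  also have "\<dots> = ((-1) ^ m * (-1) ^ m) * pgain l" unfolding \<omega>2 by (simp add: \<omega>_def)
  finally have \<omega>l: "\<omega> ^ l = pgain l" by (simp add: power_add[symmetric] mult_2[symmetric])
  have \<omega>0: "\<omega> \<noteq> 0" using \<omega>2 by auto
  \<comment> \<open>Dividing by \<open>pgain j\<close> undoes the rescaling; the result is periodic
    with period \<open>l\<close> and so descends to vertices.\<close>
  define F where "F j = \<omega> ^ j / pgain j" for j
  have "F (j + l) = F j" for j
    using \<omega>l by (simp add: F_def pgain_add_length power_add)
  note F_period = this
  have "F (j + k * l) = F j" for j k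
  proof (induction k)
    case (Suc k)
    have "j + Suc k * l = (j + k * l) + l" by simp
    then show ?case using F_period[of "j + k * l"] Suc by metis
  qed simp
  from this[of "_ mod l" "_ div l"] have F_mod: "F (j mod l) = F j" for j
    by (metis mod_mult_div_eq mult.commute)
  define x where "x v = F (THE i. i < l \<and> us ! i = v)" for v
  have x: "x (vert j) = F j" for j
  proof -
    have "(THE i. i < l \<and> us ! i = vert j) = j mod l"
      using length_pos distinct_us by (intro the_equality) (auto simp: vert_def nth_eq_iff_index_eq)
    then show ?thesis by (simp add: x_def F_mod)
  qed
  have "(\<Sum>v\<in>set us. h (vert (Suc j)) v * x v) = 0" for j
  proof -
    have "gain (Suc j) * F (Suc (Suc j)) = (\<omega> * \<omega>) * \<omega> ^ j / (pgain j * gain j)"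
      by (simp add: F_def pgain_Suc)
    also have "\<dots> = - (inverse (gain j) * F j)"
      unfolding \<omega>2 by (simp add: F_def field_simps)
    finally show ?thesis unfolding row_sum x by simp
  qed
  then have "(\<Sum>v\<in>set us. h u v * x v) = 0" if u: "u \<in> set us" for u
  proof -
    obtain j where "u = vert j" using u set_us by auto
    \<comment> \<open>Shifting by a full period writes every vertex, also the one at index 0, as a
      successor.\<close>
    then have "u = vert (Suc (j + l - 1))" using length_pos vert_add_length[of j] by simp
    then show ?thesis using \<open>\<And>j. (\<Sum>v\<in>set us. h (vert (Suc j)) v * x v) = 0\<close> by simp
  qed
  moreover have "x (vert 0) \<noteq> 0" "vert 0 \<in> set us" using x \<omega>0 set_us by (auto simp: F_def)
  ultimately show ?thesis by blast
qed

end

lemma (in chordless_gain_cycle) cycle_gain_eq_pgain: "cycle_gain \<phi> (zip us (rotate1 us)) = pgain l"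
proof -
  have "cycle_gain \<phi> (zip us (rotate1 us)) = (\<Prod>i = 0..<l. \<phi> (us ! i, rotate1 us ! i))"
    unfolding cycle_gain_def prod.list_conv_set_nth by (intro prod.cong) auto
  also have "\<dots> = pgain l"
    unfolding pgain_def gain_def vert_def by (intro prod.cong) (auto simp: nth_rotate1)
  finally show ?thesis .
qed

section \<open>The rank when the cycles form a maximal disjoint family\<close>

locale gain_cycles = maximal_disjoint_odd_cycles V R \<C> + unit_gain_relation V R \<phi>
  for V :: "'a set" and R \<C> \<phi>
begin

lemma cycle_is_chordless:
  assumes us: "rel_cycle R us" shows "chordless_gain_cycle V R \<phi> us"
proof unfold_locales
  obtain C where C: "C \<in> \<C>" "set us = set C" "cyclic_edges us = cyclic_edges C"
    using cycle_same_vertices[OF us] .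
  show "rel_cycle R us" by fact
  show "{u, v} \<in> cyclic_edges us" if "(u, v) \<in> R" "u \<in> set us" "v \<in> set us" for u v
    using cycle_chordless[OF C(1)] that C by simp
  have "length us = length C"
    using us cycle_in[OF C(1)] C(2) distinct_card[of us] distinct_card[of C] by (simp add: rel_cycle_def)
  then show "odd (length us)" using odd_cycles[OF C(1)] by simp
qed

text \<open>
  A nonzero kernel vector would give a subgraph off the cycles with too many edges for a forest,
  since every row in its support has at least two nonzero entries there.
\<close>

lemma matched_kernel_trivial:
  assumes fin: "finite K" and inj: "inj_on a K" "inj_on b K"
    and off: "a ` K \<subseteq> V - O\<C>" "b ` K \<subseteq> V - O\<C>" "a ` K \<inter> b ` K = {}"
    and ab: "\<And>k. k \<in> K \<Longrightarrow> (a k, b k) \<in> R"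
    and ker: "\<And>k. k \<in> K \<Longrightarrow> (\<Sum>k'\<in>K. h (a k) (b k') * y k') = 0"
    and k: "k \<in> K"
  shows "y k = 0"
proof (rule ccontr)
  assume yk: "y k \<noteq> 0"
  define s where "s = {k\<in>K. y k \<noteq> 0}"
  have s: "s \<subseteq> K" "finite s" "k \<in> s" using fin k yk by (auto simp: s_def)
  have inj_s: "inj_on a s" "inj_on b s" using inj s(1) inj_on_subset by blast+
  let ?A = "a ` s \<union> b ` s"
  have A: "?A \<subseteq> V - O\<C>" "a ` s \<inter> b ` s = {}" using off s(1) by blast+
  have cA: "card ?A = 2 * card s"
    using s(2) A(2) inj_s by (simp add: card_Un_disjoint card_image)
  interpret A: finite_symmetric_relation ?A "R \<inter> ?A \<times> ?A" by (rule restrict) (use A(1) in blast)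
  have "\<nexists>us. rel_cycle (R \<inter> ?A \<times> ?A) us"
  proof
    assume "\<exists>us. rel_cycle (R \<inter> ?A \<times> ?A) us"
    then obtain us where us: "rel_cycle (R \<inter> ?A \<times> ?A) us" by blast
    then have "rel_cycle R us" by (simp add: rel_cycle_def)
    then obtain C where C: "C \<in> \<C>" "set us = set C" using cycle_same_vertices by metis
    have "set C \<subseteq> ?A" using A.rel_cycle_subset_verts[OF us] C(2) by simp
    moreover obtain u where "u \<in> set C" using cycle_nonempty[OF C(1)] by blast
    ultimately show False using A(1) C(1) by blast
  qed
  then have few: "card (R \<inter> ?A \<times> ?A) + 2 \<le> 4 * card s"
    using A.acyclic_card_rel s(3) cA by auto
  have deg: "2 \<le> card (R `` {u} \<inter> b ` s)" if u: "u \<in> a ` s" for u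
  proof (rule ccontr)
    assume small: "\<not> 2 \<le> card (R `` {u} \<inter> b ` s)"
    obtain i where i: "i \<in> s" "u = a i" using u by auto
    then have iK: "i \<in> K" using s(1) by auto
    have "b i \<in> R `` {u} \<inter> b ` s" using ab[OF iK] i by auto
    moreover have "finite (R `` {u} \<inter> b ` s)" using s(2) by simp
    ultimately have single: "w = b i" if "w \<in> R `` {u} \<inter> b ` s" for w
      using small that card_mono[of "R `` {u} \<inter> b ` s" "{w, b i}"] by (cases "w = b i") auto
    \<comment> \<open>With \<open>b i\<close> as the only neighbour in the support, row
      \<open>a i\<close> would reduce to a single nonzero term.\<close>
    have "(\<Sum>k'\<in>K. h (a i) (b k') * y k') = (\<Sum>k'\<in>{i}. h (a i) (b k') * y k')"
    proof (rule sum.mono_neutral_right[OF fin])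
      show "\<forall>k'\<in>K - {i}. h (a i) (b k') * y k' = 0"
      proof
        fix k' assume k': "k' \<in> K - {i}"
        show "h (a i) (b k') * y k' = 0"
        proof (cases "y k' = 0")
          case False
          then have "b k' \<noteq> b i" "k' \<in> s" using k' iK inj(2) by (auto simp: s_def dest: inj_onD)
          then have "(a i, b k') \<notin> R" using single[of "b k'"] i by auto
          then show ?thesis by (simp add: h_zero)
        qed simp
      qed
    qed (use iK in simp)
    then have "h (a i) (b i) * y i = 0" using ker[OF iK] by simp
    then show False using h_nonzero_iff ab[OF iK] i(1) by (auto simp: s_def)
  qed
  \<comment> \<open>\<open>E\<close> and its converse are disjoint, giving at least
    \<open>4 * card s\<close> arcs on \<open>2 * card s\<close> vertices, whereas the forest bound
    allows \<open>4 * card s - 2\<close>.\<close>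
  define E where "E = (SIGMA u:a ` s. R `` {u} \<inter> b ` s)"
  have finE: "finite E" using s(2) by (simp add: E_def)
  have "(\<Sum>u\<in>a ` s. 2) \<le> (\<Sum>u\<in>a ` s. card (R `` {u} \<inter> b ` s))" by (rule sum_mono) (rule deg)
  also have "\<dots> = card E" unfolding E_def using s(2) by simp
  finally have cE: "2 * card s \<le> card E" using inj_s(1) by (simp add: card_image)
  have "E \<inter> E\<inverse> = {}" using A(2) by (auto simp: E_def)
  then have "card (E \<union> E\<inverse>) = 2 * card E" using finE by (simp add: card_Un_disjoint)
  moreover have "E \<union> E\<inverse> \<subseteq> R \<inter> ?A \<times> ?A" using rel_sym by (auto simp: E_def)
  then have "card (E \<union> E\<inverse>) \<le> card (R \<inter> ?A \<times> ?A)" by (intro card_mono) auto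
  ultimately show False using cE few by linarith
qed

end

locale gain_cycles_cover = gain_cycles +
  fixes K :: "'a set" and p :: "'a \<Rightarrow> 'a"
  assumes K: "K \<subseteq> V - O\<C>" and inj_p: "inj_on p K" and p_off: "p ` K \<subseteq> V - O\<C>"
    and p_K: "p ` K \<inter> K = {}" and p_rel: "k \<in> K \<Longrightarrow> (k, p k) \<in> R"
    and cover: "(u, v) \<in> R \<Longrightarrow> cls u \<noteq> cls v \<Longrightarrow> u \<in> K \<or> v \<in> K"
begin

lemma finite_K [simp]: "finite K"
  using K by (rule finite_subset) simp

lemma off_cycle_neighbour:
  assumes "(u, v) \<in> R" "u \<notin> O\<C> \<or> v \<notin> O\<C>" shows "u \<in> K \<or> v \<in> K"
proof -
  have "u \<noteq> v" using assms(1) rel_irrefl by blast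
  then have "cls u \<noteq> cls v"
    using assms(2) cls_singleton[of u] cls_singleton[of v] in_cls[of u] in_cls[of v]
    by (metis singletonD)
  then show ?thesis using cover[OF assms(1)] by blast
qed

lemma different_cycle_neighbour:
  assumes "C \<in> \<C>" "u \<in> set C" "v \<notin> set C" "(u, v) \<in> R" shows "v \<in> K"
proof -
  have "cls u = set C" using cls_cycle[OF assms(1,2)] .
  then have "cls u \<noteq> cls v" using assms(3) in_cls[of v] by auto
  moreover have "u \<notin> K" using assms(1,2) K by auto
  ultimately show ?thesis using cover[OF assms(4)] by blast
qed

lemma card_cover_support: "card (O\<C> \<union> K \<union> p ` K) = card O\<C> + 2 * card K"
proof -
  have "card (O\<C> \<union> K \<union> p ` K) = card (O\<C> \<union> K) + card (p ` K)"
    by (rule card_Un_disjoint) (use p_off p_K in auto)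
  also have "card (O\<C> \<union> K) = card O\<C> + card K"
    by (rule card_Un_disjoint) (use K in auto)
  finally show ?thesis by (simp add: card_image[OF inj_p])
qed

text \<open>The system is block triangular. Rows of the partners see only \<open>K\<close>, so
  \<open>x\<close> vanishes on \<open>K\<close>; then each cycle row reduces to its cycle block;
  finally the rows of \<open>K\<close> see only the partners.\<close>

lemma trivial_kernel_cover_support:
  assumes re: "\<And>C. C \<in> \<C> \<Longrightarrow> Re (cycle_gain \<phi> (zip C (rotate1 C))) \<noteq> 0"
  shows "trivial_kernel h (O\<C> \<union> K \<union> p ` K) (O\<C> \<union> K \<union> p ` K)" (is "trivial_kernel h ?S ?S")
  unfolding trivial_kernel_def
proof (intro allI impI ballI)
  fix x v assume x: "\<forall>i\<in>?S. (\<Sum>j\<in>?S. h i j * x j) = 0" and v: "v \<in> ?S"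
  have finS: "finite ?S" by simp
  have reduce: "(\<Sum>j\<in>B. h i j * x j) = 0"
    if "i \<in> ?S" "B \<subseteq> ?S" "\<And>j. j \<in> ?S \<Longrightarrow> j \<notin> B \<Longrightarrow> (i, j) \<in> R \<Longrightarrow> x j = 0" for i B
  proof -
    have "(\<Sum>j\<in>?S. h i j * x j) = (\<Sum>j\<in>B. h i j * x j)"
      by (rule sum.mono_neutral_right[OF finS that(2)]) (use that(3) h_zero in auto)
    then show ?thesis using x that(1) by simp
  qed
  have xK: "x k = 0" if k: "k \<in> K" for k
  proof (rule matched_kernel_trivial[of K p "\<lambda>k. k" x])
    fix k assume k: "k \<in> K"
    show "(p k, k) \<in> R" using p_rel[OF k] by (rule rel_sym)
    have pk: "p k \<notin> O\<C>" "p k \<notin> K" using k p_off p_K by auto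
    show "(\<Sum>k'\<in>K. h (p k) k' * x k') = 0"
    proof (rule reduce)
      fix j assume "j \<notin> K" "(p k, j) \<in> R"
      then show "x j = 0" using off_cycle_neighbour[of "p k" j] pk by blast
    qed (use k in auto)
  qed (use K inj_p p_off p_K k in auto)
  have xO: "x u = 0" if C: "C \<in> \<C>" and u: "u \<in> set C" for C u
  proof -
    interpret C: chordless_gain_cycle V R \<phi> C by (rule cycle_is_chordless[OF cycle_in[OF C]])
    have "trivial_kernel h (set C) (set C)"
      using re[OF C] C.trivial_kernel_cycle by (simp add: C.cycle_gain_eq_pgain)
    then show "x u = 0"
    proof (rule trivial_kernelD[OF _ _ u])
      fix i assume i: "i \<in> set C"
      show "(\<Sum>j\<in>set C. h i j * x j) = 0"
      proof (rule reduce)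
        fix j assume "j \<notin> set C" "(i, j) \<in> R"
        then show "x j = 0" using different_cycle_neighbour[OF C i] xK by blast
      qed (use i C in auto)
    qed
  qed
  have xp: "x (p k) = 0" if k: "k \<in> K" for k
  proof (rule matched_kernel_trivial[of K "\<lambda>k. k" p "\<lambda>k. x (p k)"])
    fix k assume k: "k \<in> K"
    show "(k, p k) \<in> R" using p_rel[OF k] .
    have "(\<Sum>j\<in>p ` K. h k j * x j) = 0"
      by (rule reduce) (use k xK xO in auto)
    then show "(\<Sum>k'\<in>K. h k (p k') * x (p k')) = 0" by (simp add: sum.reindex[OF inj_p])
  qed (use K inj_p p_off p_K k in auto)
  show "x v = 0" using v xK xO xp by auto
qed

text \<open>Vertices outside \<open>K\<close> and the cycles have neighbours only in
  \<open>K\<close>. If \<open>S\<close> had more of them than elements of \<open>K\<close>, an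
  underdetermined system would give a kernel vector supported there.\<close>

lemma trivial_kernel_card_bounds:
  assumes S: "S \<subseteq> V" and tk: "trivial_kernel h S S"
  shows "card (S - O\<C> - K) \<le> card (S \<inter> K)" "card S \<le> 2 * card (S \<inter> K) + card (S \<inter> O\<C>)"
proof -
  let ?N = "S - O\<C> - K"
  have fin: "finite S" using S finite_subset finite_verts by blast
  show le: "card ?N \<le> card (S \<inter> K)"
  proof (rule ccontr)
    assume "\<not> ?thesis"
    then obtain x where x: "\<exists>j\<in>?N. x j \<noteq> 0" "\<And>i. i \<in> S \<inter> K \<Longrightarrow> (\<Sum>j\<in>?N. h i j * x j) = 0"
      using underdetermined_system_has_nonzero_solution[of "S \<inter> K" ?N h] fin by auto
    define y where "y j = (if j \<in> ?N then x j else 0)" for j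
    have "(\<Sum>j\<in>S. h i j * y j) = 0" if i: "i \<in> S" for i
    proof -
      have "(\<Sum>j\<in>S. h i j * y j) = (\<Sum>j\<in>?N. h i j * x j)"
        by (rule sum.mono_neutral_cong_right) (use fin in \<open>auto simp: y_def\<close>)
      moreover have "(\<Sum>j\<in>?N. h i j * x j) = 0" if "i \<notin> K"
      proof (rule sum.neutral, rule ballI)
        fix j assume "j \<in> ?N"
        then have "(i, j) \<notin> R" using off_cycle_neighbour[of i j] that by blast
        then show "h i j * x j = 0" by (simp add: h_zero)
      qed
      ultimately show ?thesis using x(2)[of i] i by (cases "i \<in> K") auto
    qed
    from trivial_kernelD[OF tk this] have "y j = 0" if "j \<in> S" for j using that by blast
    moreover have "y j = x j" if "j \<in> ?N" for j using that by (simp add: y_def)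
    ultimately show False using x(1) by (metis DiffD1)
  qed
  have "S = (S \<inter> K) \<union> ((S \<inter> O\<C>) \<union> ?N)" by auto
  then have "card S \<le> card (S \<inter> K) + card ((S \<inter> O\<C>) \<union> ?N)" by (metis card_Un_le)
  also have "card ((S \<inter> O\<C>) \<union> ?N) \<le> card (S \<inter> O\<C>) + card ?N" by (rule card_Un_le)
  finally show "card S \<le> 2 * card (S \<inter> K) + card (S \<inter> O\<C>)" using le by linarith
qed

lemma trivial_kernel_card_le:
  assumes "S \<subseteq> V" "trivial_kernel h S S" shows "card S \<le> 2 * card K + card O\<C>"
  using trivial_kernel_card_bounds(2)[OF assms] card_mono[of K "S \<inter> K"] card_mono[of O\<C> "S \<inter> O\<C>"]
  by (simp add: mult_2)

text \<open>
  If some cycle has purely imaginary gain, a kernel vector of that cycle can be corrected on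
  the vertices outside \<open>K\<close> and the cycles, since those have neighbours in \<open>K\<close> only.
\<close>

lemma trivial_kernel_card_less:
  assumes S: "S \<subseteq> V" and tk: "trivial_kernel h S S"
    and us: "rel_cycle R us" and re: "Re (cycle_gain \<phi> (zip us (rotate1 us))) = 0"
  shows "card S < 2 * card K + card O\<C>"
proof (rule ccontr)
  assume "\<not> ?thesis"
  then have big: "2 * card K + card O\<C> \<le> card S" by simp
  let ?N = "S - O\<C> - K"
  have fin: "finite S" using S finite_subset finite_verts by blast
  note b = trivial_kernel_card_bounds[OF S tk]
  have le: "card (S \<inter> K) \<le> card K" "card (S \<inter> O\<C>) \<le> card O\<C>"
    by (simp_all add: card_mono)
  \<comment> \<open>Maximal size makes the bounds tight: \<open>S\<close> contains all of
    \<open>K\<close> and \<open>O\<C>\<close>, and hence at least \<open>card K\<close> further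
    vertices.\<close>
  have eq: "card (S \<inter> K) = card K" "card (S \<inter> O\<C>) = card O\<C>" using b le big by linarith+
  have SK: "S \<inter> K = K" by (rule card_subset_eq) (use eq in auto)
  have SO: "S \<inter> O\<C> = O\<C>" by (rule card_subset_eq[OF finite_O]) (use eq in auto)
  have cN: "card K \<le> card ?N"
  proof -
    have "S = K \<union> (O\<C> \<union> ?N)" using SK SO by auto
    then have "card S \<le> card K + card (O\<C> \<union> ?N)" by (metis card_Un_le)
    also have "card (O\<C> \<union> ?N) \<le> card O\<C> + card ?N" by (rule card_Un_le)
    finally show ?thesis using big by linarith
  qed
  interpret us: chordless_gain_cycle V R \<phi> us by (rule cycle_is_chordless[OF us])
  obtain C where C: "C \<in> \<C>" "set us = set C" using cycle_same_vertices[OF us] by metis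
  obtain y where y: "\<exists>u\<in>set us. y u \<noteq> 0" "\<And>u. u \<in> set us \<Longrightarrow> (\<Sum>v\<in>set us. h u v * y v) = 0"
    using us.kernel_cycle re by (auto simp: us.cycle_gain_eq_pgain)
  \<comment> \<open>\<open>None\<close> stands for the whole cycle vector \<open>y\<close> as one
    extra column. That gives at least \<open>card K + 1\<close> unknowns for the
    \<open>card K\<close> equations in the rows of \<open>K\<close>; all other rows vanish
    anyway.\<close>
  define J where "J = insert None (Some ` ?N)"
  define a where "a k j = (case j of None \<Rightarrow> \<Sum>v\<in>set us. h k v * y v | Some v \<Rightarrow> h k v)" for k j
  have sum_J: "(\<Sum>j\<in>J. a k j * x j) = a k None * x None + (\<Sum>v\<in>?N. h k v * x (Some v))" for k x
    unfolding J_def using fin by (subst sum.insert) (auto simp: a_def sum.reindex)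
  have "card K < card J" using cN fin by (simp add: J_def card_image)
  then obtain x where x: "\<exists>j\<in>J. x j \<noteq> 0" "\<And>k. k \<in> K \<Longrightarrow> (\<Sum>j\<in>J. a k j * x j) = 0"
    using underdetermined_system_has_nonzero_solution[of K J a] fin by (auto simp: J_def)
  define w where "w v = (if v \<in> set us then x None * y v else if v \<in> ?N then x (Some v) else 0)" for v
  have usO: "set us \<subseteq> O\<C>" using C by auto
  have sum_w: "(\<Sum>v\<in>S. h u v * w v) = a u None * x None + (\<Sum>v\<in>?N. h u v * x (Some v))" for u
  proof -
    have "(\<Sum>v\<in>S. h u v * w v) = (\<Sum>v\<in>set us \<union> ?N. h u v * w v)"
      by (rule sum.mono_neutral_right) (use fin usO SO in \<open>auto simp: w_def\<close>)
    also have "\<dots> = (\<Sum>v\<in>set us. h u v * w v) + (\<Sum>v\<in>?N. h u v * w v)"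
      by (rule sum.union_disjoint) (use fin usO in auto)
    also have "(\<Sum>v\<in>?N. h u v * w v) = (\<Sum>v\<in>?N. h u v * x (Some v))"
      by (rule sum.cong[OF refl]) (use usO in \<open>auto simp: w_def\<close>)
    also have "(\<Sum>v\<in>set us. h u v * w v) = a u None * x None"
      by (simp add: a_def w_def sum_distrib_right mult.assoc mult.commute[of "x None"])
    finally show ?thesis .
  qed
  have "(\<Sum>v\<in>S. h u v * w v) = 0" if u: "u \<in> S" for u
  proof (cases "u \<in> K")
    case True
    then show ?thesis using x(2)[OF True] unfolding sum_w sum_J by simp
  next
    case False
    have "(\<Sum>v\<in>?N. h u v * x (Some v)) = 0"
    proof (rule sum.neutral, rule ballI)
      fix v assume "v \<in> ?N"
      then have "(u, v) \<notin> R" using off_cycle_neighbour[of u v] False by blast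
      then show "h u v * x (Some v) = 0" by (simp add: h_zero)
    qed
    moreover have "a u None = 0"
    proof (cases "u \<in> set us")
      case True
      then show ?thesis using y(2) by (simp add: a_def)
    next
      case False': False
      have "h u v = 0" if v: "v \<in> set us" for v
      proof (rule h_zero, rule notI)
        assume "(u, v) \<in> R"
        then have "(v, u) \<in> R" by (rule rel_sym)
        then show False using different_cycle_neighbour[OF C(1), of v u] C(2) v False False' by auto
      qed
      then show ?thesis by (simp add: a_def)
    qed
    ultimately show ?thesis unfolding sum_w by simp
  qed
  note w = trivial_kernelD[OF tk this]
  obtain u where u: "u \<in> set us" "y u \<noteq> 0" using y(1) by blast
  have "u \<in> S" using u(1) usO SO by blast
  then have "x None = 0" using w[of u] u by (simp add: w_def)
  moreover have "x (Some v) = 0" if v: "v \<in> ?N" for v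
  proof -
    have "v \<notin> set us" using v usO by blast
    then show ?thesis using w[of v] v by (simp add: w_def)
  qed
  ultimately show False using x(1) by (auto simp: J_def)
qed

end

context gain_cycles
begin

text \<open>\<open>card S\<close> plays the role of the rank, being the largest size of a vertex set
  with trivial kernel.\<close>

lemma rank_eq_iff_real_parts:
  assumes m: "rel_matching_number T = rel_matching_number RO"
    and att: "S \<subseteq> V" "trivial_kernel h S S"
    and max: "\<And>S'. S' \<subseteq> V \<Longrightarrow> trivial_kernel h S' S' \<Longrightarrow> card S' \<le> card S"
  shows "card S = 2 * rel_matching_number R + card \<C>
    \<longleftrightarrow> (\<forall>us. rel_cycle R us \<longrightarrow> Re (cycle_gain \<phi> (zip us (rotate1 us))) \<noteq> 0)"
proof -
  obtain K p where Kp: "K \<subseteq> V - O\<C>" "card K = rel_matching_number T" "inj_on p K" "p ` K \<subseteq> V - O\<C>"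
    "p ` K \<inter> K = {}" "\<And>k. k \<in> K \<Longrightarrow> (k, p k) \<in> R"
    "\<And>u v. (u, v) \<in> R \<Longrightarrow> cls u \<noteq> cls v \<Longrightarrow> u \<in> K \<or> v \<in> K"
    using cover_off_cycles[OF m] by metis
  interpret gain_cycles_cover V R \<C> \<phi> K p
    using Kp(1,3-7) by unfold_locales
  have c: "2 * rel_matching_number R + card \<C> = 2 * card K + card O\<C>"
    using matching_number_le_cover[OF finite_K cover] T_matching_number_lift Kp(2) by linarith
  show ?thesis
  proof
    assume eq: "card S = 2 * rel_matching_number R + card \<C>"
    show "\<forall>us. rel_cycle R us \<longrightarrow> Re (cycle_gain \<phi> (zip us (rotate1 us))) \<noteq> 0"
    proof (intro allI impI notI)
      fix us assume "rel_cycle R us" "Re (cycle_gain \<phi> (zip us (rotate1 us))) = 0"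
      from trivial_kernel_card_less[OF att this] show False using eq c by linarith
    qed
  next
    assume "\<forall>us. rel_cycle R us \<longrightarrow> Re (cycle_gain \<phi> (zip us (rotate1 us))) \<noteq> 0"
    then have "trivial_kernel h (O\<C> \<union> K \<union> p ` K) (O\<C> \<union> K \<union> p ` K)"
      using cycle_in by (intro trivial_kernel_cover_support) blast
    moreover have "O\<C> \<union> K \<union> p ` K \<subseteq> V" using O_subset Kp(1,4) by blast
    ultimately have "card O\<C> + 2 * card K \<le> card S" using max card_cover_support by metis
    then show "card S = 2 * rel_matching_number R + card \<C>"
      using trivial_kernel_card_le[OF att] c by linarith
  qed
qed

end

section \<open>The extremal case of the rank bound\<close>

context unit_gain_relation
begin

text \<open>
  A transversal of a nonsingular principal submatrix covers its index set by a matching and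
  disjoint odd cycles, which gives \<open>card S \<le> 2 m + c\<close>; equality forces all cycles to be used.
\<close>

lemma extremal_rank_imp_odd_cycles:
  assumes conn: "connected_rel V R" and ne: "V \<noteq> {}"
    and S: "S \<subseteq> V" and tk: "trivial_kernel h S S"
    and eq: "2 * card S + 2 * card V = 4 * rel_matching_number R + card R + 2"
  obtains \<C> where "maximal_disjoint_odd_cycles V R \<C>"
    "rel_matching_number (contracted_rel \<C> R)
      = rel_matching_number (R \<inter> (V - (\<Union>C\<in>\<C>. set C)) \<times> (V - (\<Union>C\<in>\<C>. set C)))"
proof -
  have finS: "finite S" by (rule finite_subset[OF S]) simp
  obtain \<sigma> where \<sigma>: "bij_betw \<sigma> S S" "\<forall>i\<in>S. h i (\<sigma> i) \<noteq> 0"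
    using trivial_kernel_imp_transversal[OF finS finS refl tk] by blast
  have "\<exists>M \<C>. rel_matching R M \<and> disjoint_cycles R \<C> \<and> (\<forall>C\<in>\<C>. odd (length C))
     \<and> \<Union>M \<union> (\<Union>C\<in>\<C>. set C) = S \<and> \<Union>M \<inter> (\<Union>C\<in>\<C>. set C) = {}"
    by (rule permutation_along_arcs_decomposition[OF finS \<sigma>(1)]) (use \<sigma>(2) h_nonzero_iff in blast)
  then obtain M \<C> where M: "rel_matching R M" and \<C>: "disjoint_cycles R \<C>" "\<forall>C\<in>\<C>. odd (length C)"
    and part: "\<Union>M \<union> (\<Union>C\<in>\<C>. set C) = S" "\<Union>M \<inter> (\<Union>C\<in>\<C>. set C) = {}"
    by (elim exE conjE)
  let ?O = "\<Union>C\<in>\<C>. set C"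
  have fin\<C>: "finite \<C>" using \<C>(1) by (simp add: disjoint_cycles_def)
  have finO: "finite ?O" using fin\<C> by simp
  have cS: "card S = 2 * card M + card ?O"
  proof -
    have "finite (\<Union>M)" by (rule finite_subset[OF rel_matching_subset_verts[OF M]]) simp
    then show ?thesis
      unfolding part(1)[symmetric] using finO part(2) card_Union_rel_matching[OF M]
      by (simp add: card_Un_disjoint)
  qed
  have sum_O: "(\<Sum>C\<in>\<C>. length C) = card ?O"
  proof -
    have "card ?O = (\<Sum>C\<in>\<C>. card (set C))"
      by (rule card_UN_disjoint) (use \<C>(1) in \<open>auto simp: disjoint_cycles_def\<close>)
    also have "\<dots> = (\<Sum>C\<in>\<C>. length C)"
      by (rule sum.cong[OF refl]) (use \<C>(1) distinct_card in \<open>auto simp: disjoint_cycles_def rel_cycle_def\<close>)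
    finally show ?thesis by simp
  qed
  have "\<exists>v\<in>set C. \<Union>M \<inter> set C \<subseteq> {v}" if C: "C \<in> \<C>" for C
  proof -
    have "C \<noteq> []" using \<C>(1) C by (auto simp: disjoint_cycles_def rel_cycle_def)
    then have "hd C \<in> set C" by simp
    moreover have "\<Union>M \<inter> set C = {}" using part(2) C by blast
    ultimately show ?thesis by blast
  qed
  then obtain N where N: "rel_matching R N" "2 * card N + card \<C> = 2 * card M + (\<Sum>C\<in>\<C>. length C)"
    using extend_matching_by_odd_cycles[OF M \<C>(1)] \<C>(2) by blast
  have "card S \<le> 2 * rel_matching_number R + card \<C>"
    using rel_matching_number_ge[OF N(1)] N(2) sum_O cS by linarith
  moreover have "2 * card V + 2 * card \<C> \<le> card R + 2"
    by (rule disjoint_cycles_le_cyclomatic[OF conn ne \<C>(1)])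
  \<comment> \<open>Twice the first inequality plus the second gives \<open>eq\<close> with an
    inequality sign, so both are tight.\<close>
  ultimately have cR: "card R + 2 = 2 * card V + 2 * card \<C>"
    and cS': "card S = 2 * rel_matching_number R + card \<C>" using eq by linarith+
  interpret \<C>: maximal_disjoint_odd_cycles V R \<C>
    by unfold_locales (use conn ne \<C> cR in auto)
  have "rel_matching (R \<inter> (V - ?O) \<times> (V - ?O)) M"
    unfolding rel_matching_def
  proof (intro conjI subsetI)
    fix e assume e: "e \<in> M"
    obtain u v where uv: "e = {u, v}" "(u, v) \<in> R" "u \<noteq> v" by (rule rel_matching_edge[OF M e])
    then have "u \<in> \<Union>M" "v \<in> \<Union>M" using e by auto
    then have "(u, v) \<in> R \<inter> (V - ?O) \<times> (V - ?O)" using uv(2) part(2) rel_in_verts by blast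
    then show "e \<in> (\<lambda>(u, v). {u, v}) ` (R \<inter> (V - ?O) \<times> (V - ?O))"
      using uv(1) by (intro image_eqI[of _ _ "(u, v)"]) auto
  qed (use M in \<open>simp add: rel_matching_def\<close>)
  then have "card M \<le> rel_matching_number (R \<inter> (V - ?O) \<times> (V - ?O))"
    by (rule \<C>.RO.rel_matching_number_ge)
  \<comment> \<open>Both sizes of \<open>S\<close> are compared here:
    \<open>2 * card M + card ?O\<close> from the partition and \<open>2 * m + card \<C>\<close> from
    tightness. So \<open>M\<close>, which avoids the cycles, is as large as any matching of the
    contraction.\<close>
  moreover have "2 * rel_matching_number (contracted_rel \<C> R) + card ?O \<le> 2 * card M + card ?O"
    using \<C>.T_matching_number_lift cS cS' by linarith
  ultimately have "rel_matching_number (contracted_rel \<C> R) = rel_matching_number (R \<inter> (V - ?O) \<times> (V - ?O))"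
    using \<C>.RO_matching_number_le by linarith
  then show thesis using that \<C>.maximal_disjoint_odd_cycles_axioms by blast
qed

lemma h_cnj: "h u v = cnj (h v u)"
proof (cases "(u, v) \<in> R")
  case True
  then have vu: "(v, u) \<in> R" by (rule rel_sym)
  have "\<phi> (v, u) * cnj (\<phi> (v, u)) = 1"
    using unit[OF vu] by (simp add: complex_norm_square[symmetric])
  then have "inverse (\<phi> (v, u)) = cnj (\<phi> (v, u))" by (rule inverse_unique)
  then show ?thesis using inverse_gain[OF True] True vu by (simp add: gain_weight_def)
next
  case False
  then have "(v, u) \<notin> R" using rel_sym by blast
  then show ?thesis using False by (simp add: h_zero)
qed

end

lemma trivial_kernel_reindex:
  assumes "inj_on f I"
  shows "trivial_kernel (\<lambda>i j. a (f i) (f j)) I I \<longleftrightarrow> trivial_kernel a (f ` I) (f ` I)"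
proof
  assume tk: "trivial_kernel (\<lambda>i j. a (f i) (f j)) I I"
  show "trivial_kernel a (f ` I) (f ` I)"
    unfolding trivial_kernel_def
  proof (intro allI impI)
    fix x assume "\<forall>i\<in>f ` I. (\<Sum>j\<in>f ` I. a i j * x j) = 0"
    then have "(\<Sum>j\<in>I. a (f i) (f j) * x (f j)) = 0" if "i \<in> I" for i
      using that by (simp add: sum.reindex[OF assms])
    from trivial_kernelD[OF tk this] show "\<forall>j\<in>f ` I. x j = 0" by auto
  qed
next
  assume tk: "trivial_kernel a (f ` I) (f ` I)"
  show "trivial_kernel (\<lambda>i j. a (f i) (f j)) I I"
    unfolding trivial_kernel_def
  proof (intro allI impI)
    fix x assume x: "\<forall>i\<in>I. (\<Sum>j\<in>I. a (f i) (f j) * x j) = 0"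
    define y where "y v = x (inv_into I f v)" for v
    have y: "y (f j) = x j" if "j \<in> I" for j using that assms by (simp add: y_def)
    have "(\<Sum>j\<in>f ` I. a i j * y j) = 0" if "i \<in> f ` I" for i
    proof -
      obtain k where k: "k \<in> I" "i = f k" using \<open>i \<in> f ` I\<close> by auto
      have "(\<Sum>j\<in>f ` I. a i j * y j) = (\<Sum>j\<in>I. a (f k) (f j) * y (f j))"
        by (simp add: sum.reindex[OF assms] k(2))
      also have "\<dots> = (\<Sum>j\<in>I. a (f k) (f j) * x j)" by (rule sum.cong[OF refl]) (simp add: y)
      finally show ?thesis using x k(1) by simp
    qed
    from trivial_kernelD[OF tk this] show "\<forall>j\<in>I. x j = 0" using y by auto
  qed
qed

section \<open>Translation to the graph-theoretic notions\<close>

lemma matching_eq_rel_matching: "matching H M \<longleftrightarrow> rel_matching (arcs_ends H) M"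
  by (simp add: matching_def rel_matching_def edges_def)

lemma matching_number_eq: "matching_number H = rel_matching_number (arcs_ends H)"
  by (simp add: matching_number_def rel_matching_number_def matching_eq_rel_matching)

lemma pcas_iff: "pcas u p v \<longleftrightarrow> u # map snd p = map fst p @ [v]"
  by (induction p arbitrary: u) auto

lemma pawalk_verts_eq: "pcas u p v \<Longrightarrow> pawalk_verts u p = u # map snd p"
  by (induction p arbitrary: u) auto

lemma (in pair_graph) finite_symmetric_relation: "finite_symmetric_relation (pverts G) (parcs G)"
proof unfold_locales
  show "(v, u) \<in> parcs G" if "(u, v) \<in> parcs G" for u v
    using that pair_sym_arcs by (auto simp: symmetric_def sym_def)
  show "(u, u) \<notin> parcs G" for u using pair_no_loops[of "(u, u)"] by auto
qed (use pair_finite_verts in_arcsD1 in_arcsD2 in auto)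

text \<open>A closed walk satisfies \<open>u # map snd p = map fst p @ [u]\<close>, so its heads are
  its tails rotated by one.\<close>

lemma (in pair_graph) graph_cycle_iff:
  "graph_cycle G p \<longleftrightarrow> (\<exists>us. rel_cycle (parcs G) us \<and> p = zip us (rotate1 us))"
proof
  assume "graph_cycle G p"
  then obtain u where u: "set p \<subseteq> parcs G" "pcas u p u" "distinct (tl (pawalk_verts u p))" "3 \<le> length p"
    by (auto simp: graph_cycle_def cycle_def awalk_def)
  define us where "us = map fst p"
  have d: "distinct (map snd p)" using u pawalk_verts_eq by fastforce
  have eq: "u # map snd p = us @ [u]" using u(2) pcas_iff us_def by metis
  obtain xs where us: "us = u # xs" using eq u(4) by (cases us) (auto simp: us_def)
  then have rot: "map snd p = rotate1 us" using eq by simp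
  then have p: "p = zip us (rotate1 us)" by (metis us_def zip_map_fst_snd)
  have "distinct us" using d rot by simp
  moreover have "cyclic_arcs us \<subseteq> parcs G" using u(1) unfolding cyclic_arcs_def p[symmetric] .
  moreover have "3 \<le> length us" using u(4) by (simp add: us_def)
  ultimately have "rel_cycle (parcs G) us" by (simp add: rel_cycle_def)
  then show "\<exists>us. rel_cycle (parcs G) us \<and> p = zip us (rotate1 us)" using p by blast
next
  assume "\<exists>us. rel_cycle (parcs G) us \<and> p = zip us (rotate1 us)"
  then obtain us where us: "rel_cycle (parcs G) us" "p = zip us (rotate1 us)" by blast
  then have l: "3 \<le> length us" "distinct us" "set p \<subseteq> parcs G"
    by (auto simp: rel_cycle_def cyclic_arcs_def)
  then obtain u xs where xs: "us = u # xs" by (cases us) auto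
  have maps: "map fst p = us" "map snd p = rotate1 us" using us(2) by auto
  have cas: "pcas u p u" unfolding pcas_iff maps xs by simp
  have "u \<in> fst ` set p" using maps xs by (metis list.set_intros(1) set_map)
  then have "u \<in> pverts G" using l(3) in_arcsD1 by fastforce
  moreover have "distinct (tl (pawalk_verts u p))"
    using pawalk_verts_eq[OF cas] maps l(2) by simp
  moreover have "p \<noteq> []" using l(1) us(2) by (cases us) auto
  ultimately show "graph_cycle G p"
    using cas l us(2) by (auto simp: graph_cycle_def cycle_def awalk_def)
qed

lemma cycle_verts_zip: "cycle_verts (zip us (rotate1 us)) = set us"
  using fst_cyclic_arcs[of us] by (simp add: cycle_verts_def cyclic_arcs_def)

lemma cycle_edges_zip: "cycle_edges (zip us (rotate1 us)) = cyclic_edges us"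
  by (simp add: cycle_edges_def cyclic_edges_def cyclic_arcs_def)

context pair_graph
begin

lemma connected_imp_connected_rel:
  assumes "connected (with_proj G)"
  shows "connected_rel (pverts G) (parcs G)" "pverts G \<noteq> {}" "card (pre_digraph.sccs (with_proj G)) = 1"
proof -
  have sc: "strongly_connected (with_proj G)"
    using symmetric_connected_imp_strongly_connected[OF pair_sym_arcs assms] .
  then show ne: "pverts G \<noteq> {}" by (simp add: strongly_connected_def)
  have reach: "u \<rightarrow>\<^sup>*\<^bsub>with_proj G\<^esub> v" if "u \<in> pverts G" "v \<in> pverts G" for u v
    using sc that by (simp add: strongly_connected_def)
  have "(u, v) \<in> (parcs G)\<^sup>*" if "u \<in> pverts G" "v \<in> pverts G" for u v
    using reachable_rtranclI[OF reach[OF that]] by simp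
  then show "connected_rel (pverts G) (parcs G)" by (simp add: connected_rel_def)
  have "sccs_verts = {pverts G}"
  proof (intro equalityI subsetI)
    fix S assume S: "S \<in> sccs_verts"
    then have "S \<subseteq> pverts G"
      unfolding in_sccs_verts_conv_reachable using reachable_in_verts by fastforce
    obtain u where u: "u \<in> S" using S unfolding in_sccs_verts_conv_reachable by blast
    have "v \<in> S" if "v \<in> pverts G" for v
      using S u that reach \<open>S \<subseteq> pverts G\<close> unfolding in_sccs_verts_conv_reachable by blast
    then have "pverts G \<subseteq> S" by (rule subsetI)
    then show "S \<in> {pverts G}" using \<open>S \<subseteq> pverts G\<close> by simp
  next
    fix S assume "S \<in> {pverts G}"
    then have S: "S = pverts G" by simp
    show "S \<in> sccs_verts"
      unfolding in_sccs_verts_conv_reachable S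
    proof (intro conjI ballI allI impI disjI1 notI)
      fix u v assume "v \<notin> pverts G" "u \<rightarrow>\<^sup>*\<^bsub>with_proj G\<^esub> v"
      then show False using reachable_in_verts(2) by blast
    qed (use ne reach in simp_all)
  qed
  then show "card (pre_digraph.sccs (with_proj G)) = 1" using card_sccs_verts by simp
qed

lemma card_edges: "2 * card (edges (with_proj G)) = card (parcs G)"
proof -
  interpret finite_symmetric_relation "pverts G" "parcs G" by (rule finite_symmetric_relation)
  have "card (parcs G) = (\<Sum>e\<in>edges (with_proj G). card {a \<in> parcs G. (\<lambda>(u, v). {u, v}) a = e})"
    unfolding edges_def with_proj_simps using card_eq_sum sum.image_gen[OF finite_rel, of "\<lambda>_. 1::nat"]
    by simp
  also have "\<dots> = (\<Sum>e\<in>edges (with_proj G). 2)"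
  proof (rule sum.cong[OF refl])
    fix e assume "e \<in> edges (with_proj G)"
    then obtain a where "a \<in> parcs G" "e = (\<lambda>(u, v). {u, v}) a" unfolding edges_def by auto
    moreover obtain u v where "a = (u, v)" by (cases a)
    ultimately have uv: "(u, v) \<in> parcs G" "e = {u, v}" by auto
    have "{a \<in> parcs G. (\<lambda>(u, v). {u, v}) a = e} = {(u, v), (v, u)}"
      using uv rel_sym by (auto simp: doubleton_eq_iff)
    moreover have "u \<noteq> v" using uv rel_irrefl by auto
    ultimately show "card {a \<in> parcs G. (\<lambda>(u, v). {u, v}) a = e} = 2" by simp
  qed
  finally show ?thesis by simp
qed

text \<open>Since all cycles have the vertex sets of members of \<open>\<C>\<close>, which are
  disjoint, \<open>same_cycle\<close> is already transitive; its closure only adds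
  reflexivity.\<close>

lemma contraction_of_maximal_cycles:
  assumes "maximal_disjoint_cycles (pverts G) (parcs G) \<C>"
  shows "on_cycles G = (\<Union>C\<in>\<C>. set C)" "parcs (contract_cycles G) = contracted_rel \<C> (parcs G)"
proof -
  interpret maximal_disjoint_cycles "pverts G" "parcs G" \<C> by fact
  have to_C: "\<exists>C\<in>\<C>. cycle_verts p = set C" if p: "graph_cycle G p" for p
  proof -
    obtain us where us: "rel_cycle (parcs G) us" "p = zip us (rotate1 us)"
      using p graph_cycle_iff by blast
    then obtain C where "C \<in> \<C>" "set us = set C" using cycle_same_vertices by metis
    then show ?thesis using us(2) cycle_verts_zip by metis
  qed
  have from_C: "graph_cycle G (zip C (rotate1 C))" if "C \<in> \<C>" for C
    using cycle_in[OF that] unfolding graph_cycle_iff by blast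
  have on_cycle_iff: "(\<exists>p. graph_cycle G p \<and> Q (cycle_verts p)) \<longleftrightarrow> (\<exists>C\<in>\<C>. Q (set C))" for Q
  proof
    assume "\<exists>p. graph_cycle G p \<and> Q (cycle_verts p)"
    then show "\<exists>C\<in>\<C>. Q (set C)" using to_C by metis
  next
    assume "\<exists>C\<in>\<C>. Q (set C)"
    then show "\<exists>p. graph_cycle G p \<and> Q (cycle_verts p)" using from_C cycle_verts_zip by metis
  qed
  show "on_cycles G = (\<Union>C\<in>\<C>. set C)"
  proof (rule Set.set_eqI)
    show "u \<in> on_cycles G \<longleftrightarrow> u \<in> (\<Union>C\<in>\<C>. set C)" for u
      unfolding on_cycles_def using on_cycle_iff[of "\<lambda>U. u \<in> U"] by simp
  qed
  have same: "(u, v) \<in> same_cycle G \<longleftrightarrow> (\<exists>C\<in>\<C>. u \<in> set C \<and> v \<in> set C)" for u v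
    unfolding same_cycle_def using on_cycle_iff[of "\<lambda>U. u \<in> U \<and> v \<in> U"] by simp
  have "contr_class G u = cls u" for u
  proof (intro equalityI subsetI)
    fix v assume "v \<in> contr_class G u"
    then have "(u, v) \<in> (same_cycle G)\<^sup>*" by (simp add: contr_class_def)
    then show "v \<in> cls u"
    proof (induction rule: rtrancl_induct)
      case (step v w)
      then obtain C where C: "C \<in> \<C>" "v \<in> set C" "w \<in> set C" using same by blast
      have "u \<in> set C"
        using step(3) C(1,2) cycles_disjointD by (auto simp: cycle_class_def)
      then show ?case using cls_cycle[OF C(1)] C(3) by simp
    qed simp
  next
    fix v assume v: "v \<in> cls u"
    show "v \<in> contr_class G u"
    proof (cases "v = u")
      case False
      then obtain C where "C \<in> \<C>" "u \<in> set C" "v \<in> set C" using v by (auto simp: cycle_class_def)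
      then show ?thesis using same by (auto simp: contr_class_def)
    qed (simp add: contr_class_def)
  qed
  then show "parcs (contract_cycles G) = contracted_rel \<C> (parcs G)"
    by (simp add: contract_cycles_def contracted_rel_def)
qed

end

lemma arcs_ends_induce: "arcs_ends (with_proj G \<restriction> U) = parcs G \<inter> U \<times> U"
  by (auto simp: arcs_ends_conv)

section \<open>The rank of the gain adjacency matrix\<close>

locale enumerated_gain_graph = complex_unit_gain_graph +
  fixes vs :: "'a list"
  assumes distinct_vs: "distinct vs" and set_vs: "set vs = pverts G"
begin

sublocale gain: unit_gain_relation "pverts G" "parcs G" \<phi>
proof -
  interpret finite_symmetric_relation "pverts G" "parcs G" by (rule finite_symmetric_relation)
  show "unit_gain_relation (pverts G) (parcs G) \<phi>" by unfold_locales (fact gain_unit, fact gain_inverse)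
qed

abbreviation "A \<equiv> gain_adj_mat vs G \<phi>"
abbreviation "h \<equiv> gain_weight (parcs G) \<phi>"

lemma A_carrier: "A \<in> carrier_mat (length vs) (length vs)"
  by (simp add: gain_adj_mat_def)

lemma A_index: "i < length vs \<Longrightarrow> j < length vs \<Longrightarrow> A $$ (i, j) = h (vs ! i) (vs ! j)"
  by (simp add: gain_adj_mat_def gain_weight_def)

lemma inj_on_vs: "I \<subseteq> {..<length vs} \<Longrightarrow> inj_on ((!) vs) I"
  using distinct_vs by (intro inj_on_nth) auto

lemma trivial_kernel_A:
  assumes "I \<subseteq> {..<length vs}"
  shows "trivial_kernel (\<lambda>i j. A $$ (i, j)) I I \<longleftrightarrow> trivial_kernel h ((!) vs ` I) ((!) vs ` I)"
proof -
  note inj = inj_on_vs[OF assms]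
  have "(\<Sum>j\<in>I. A $$ (i, j) * x j) = (\<Sum>j\<in>I. h (vs ! i) (vs ! j) * x j)" if "i \<in> I" for i x
    by (rule sum.cong[OF refl]) (use that assms A_index in auto)
  then have "trivial_kernel (\<lambda>i j. A $$ (i, j)) I I \<longleftrightarrow> trivial_kernel (\<lambda>i j. h (vs ! i) (vs ! j)) I I"
    by (simp add: trivial_kernel_def)
  then show ?thesis using trivial_kernel_reindex[OF inj] by simp
qed

lemma image_vs: "(!) vs ` {..<length vs} = pverts G"
  using set_vs by (auto simp: set_conv_nth)

text \<open>With \<open>gain_rank_ge\<close> this replaces the rank by a maximum over vertex sets,
  independent of the enumeration \<open>vs\<close>.\<close>

lemma gain_rank_attained:
  obtains S where "S \<subseteq> pverts G" "card S = gain_rank vs G \<phi>" "trivial_kernel h S S"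
proof -
  have "A $$ (i, j) = cnj (A $$ (j, i))" if "i < length vs" "j < length vs" for i j
    unfolding A_index[OF that] A_index[OF that(2,1)] by (rule gain.h_cnj)
  then obtain I where I: "I \<subseteq> {..<length vs}" "card I = gain_rank vs G \<phi>"
    "trivial_kernel (\<lambda>i j. A $$ (i, j)) I I"
    using rank_attained_by_principal_submatrix[OF A_carrier] unfolding gain_rank_def by blast
  have "card ((!) vs ` I) = gain_rank vs G \<phi>" using I(2) by (simp add: card_image inj_on_vs[OF I(1)])
  moreover have "(!) vs ` I \<subseteq> pverts G" using I(1) image_vs by blast
  ultimately show thesis using that I(3) trivial_kernel_A[OF I(1)] by blast
qed

lemma gain_rank_ge:
  assumes S: "S \<subseteq> pverts G" "trivial_kernel h S S" shows "card S \<le> gain_rank vs G \<phi>"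
proof -
  define I where "I = {i. i < length vs \<and> vs ! i \<in> S}"
  have I: "I \<subseteq> {..<length vs}" by (auto simp: I_def)
  have img: "(!) vs ` I = S" using S(1) image_vs by (auto simp: I_def)
  have "card S = card I" using card_image[OF inj_on_vs[OF I]] img by simp
  moreover have "trivial_kernel (\<lambda>i j. A $$ (i, j)) I I" using trivial_kernel_A[OF I] S(2) img by simp
  ultimately show ?thesis
    using vec_space.rank_ge_trivial_kernel[OF A_carrier I] by (simp add: gain_rank_def)
qed

end

theorem theorem1p12:
  fixes G :: "'a pair_pre_digraph" and \<phi> :: "'a \<times> 'a \<Rightarrow> complex" and vs :: "'a list"
  assumes "complex_unit_gain_graph G \<phi>"
    and "connected (with_proj G)"
    and "distinct vs" and "set vs = pverts G"
  shows "int (gain_rank vs G \<phi>)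
           = 2 * int (matching_number (with_proj G)) + cyclomatic_number (with_proj G)
     \<longleftrightarrow> cycles_vertex_disjoint G
       \<and> (\<forall>p. graph_cycle G p \<longrightarrow> odd (length p) \<and> Re (cycle_gain \<phi> p) \<noteq> 0)
       \<and> matching_number (with_proj (contract_cycles G))
           = matching_number (with_proj G \<restriction> (pverts G - on_cycles G))"
    (is "?rank \<longleftrightarrow> ?i \<and> ?ii \<and> ?iii")
proof -
  interpret complex_unit_gain_graph G \<phi> by fact
  interpret enumerated_gain_graph G \<phi> vs by unfold_locales (use assms in auto)
  let ?V = "pverts G" and ?R = "parcs G"
  note conn = connected_imp_connected_rel[OF assms(2)]
  obtain S where S: "S \<subseteq> ?V" "card S = gain_rank vs G \<phi>" "trivial_kernel h S S"
    by (rule gain_rank_attained)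
  have max: "card S' \<le> card S" if "S' \<subseteq> ?V" "trivial_kernel h S' S'" for S'
    using gain_rank_ge[OF that] S(2) by simp
  \<comment> \<open>There is one component; doubling turns edges into arcs and allows a statement
    over the naturals.\<close>
  have "2 * cyclomatic_number (with_proj G) = int (card ?R) + 2 - 2 * int (card ?V)"
    using conn(3) card_edges by (simp add: cyclomatic_number_def)
  then have rank_iff: "?rank \<longleftrightarrow> 2 * card S + 2 * card ?V = 4 * rel_matching_number ?R + card ?R + 2"
    using S(2) by (auto simp: matching_number_eq)
  have cycles: "(\<forall>p. graph_cycle G p \<longrightarrow> P p) \<longleftrightarrow> (\<forall>us. rel_cycle ?R us \<longrightarrow> P (zip us (rotate1 us)))" for P
    unfolding graph_cycle_iff by auto
  have i_iff: "?i \<longleftrightarrow> (\<forall>us ws. rel_cycle ?R us \<longrightarrow> rel_cycle ?R ws \<longrightarrow> cyclic_edges us \<noteq> cyclic_edges ws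
      \<longrightarrow> set us \<inter> set ws = {})"
  proof
    assume i: ?i
    show "\<forall>us ws. rel_cycle ?R us \<longrightarrow> rel_cycle ?R ws \<longrightarrow> cyclic_edges us \<noteq> cyclic_edges ws
      \<longrightarrow> set us \<inter> set ws = {}"
    proof (intro allI impI)
      fix us ws assume us: "rel_cycle ?R us" "rel_cycle ?R ws" "cyclic_edges us \<noteq> cyclic_edges ws"
      then have "graph_cycle G (zip us (rotate1 us))" "graph_cycle G (zip ws (rotate1 ws))"
        unfolding graph_cycle_iff by auto
      then show "set us \<inter> set ws = {}"
        using i us(3) unfolding cycles_vertex_disjoint_def by (metis cycle_edges_zip cycle_verts_zip)
    qed
  next
    assume r: "\<forall>us ws. rel_cycle ?R us \<longrightarrow> rel_cycle ?R ws \<longrightarrow> cyclic_edges us \<noteq> cyclic_edges ws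
      \<longrightarrow> set us \<inter> set ws = {}"
    show ?i
      unfolding cycles_vertex_disjoint_def
    proof (intro allI impI)
      fix p q assume pq: "graph_cycle G p \<and> graph_cycle G q \<and> cycle_edges p \<noteq> cycle_edges q"
      then obtain us ws where us: "rel_cycle ?R us" "p = zip us (rotate1 us)"
        and ws: "rel_cycle ?R ws" "q = zip ws (rotate1 ws)"
        unfolding graph_cycle_iff by (elim conjE exE)
      have "cyclic_edges us \<noteq> cyclic_edges ws" using pq unfolding us(2) ws(2) cycle_edges_zip by simp
      then have "set us \<inter> set ws = {}" by (rule r[rule_format, OF us(1) ws(1)])
      then show "cycle_verts p \<inter> cycle_verts q = {}" unfolding us(2) ws(2) cycle_verts_zip .
    qed
  qed
  \<comment> \<open>The forward direction reads off the real parts in (ii) from this, the converse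
    the rank equation.\<close>
  have equivalence: "(?rank \<longleftrightarrow> (\<forall>us. rel_cycle ?R us \<longrightarrow> Re (cycle_gain \<phi> (zip us (rotate1 us))) \<noteq> 0))"
    if "maximal_disjoint_odd_cycles ?V ?R \<C>" ?iii for \<C>
  proof -
    interpret maximal_disjoint_odd_cycles ?V ?R \<C> by fact
    interpret gain_cycles ?V ?R \<C> \<phi> by unfold_locales
    note c = contraction_of_maximal_cycles[OF maximal_disjoint_cycles_axioms]
    have "rel_matching_number T = rel_matching_number RO"
      using \<open>?iii\<close> by (simp add: matching_number_eq c arcs_ends_induce)
    from rank_eq_iff_real_parts[OF this S(1,3) max] show ?thesis
      unfolding rank_iff using card_rel by auto
  qed
  show ?thesis
  proof
    assume ?rank
    then obtain \<C> where \<C>: "maximal_disjoint_odd_cycles ?V ?R \<C>"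
      "rel_matching_number (contracted_rel \<C> ?R)
        = rel_matching_number (?R \<inter> (?V - (\<Union>C\<in>\<C>. set C)) \<times> (?V - (\<Union>C\<in>\<C>. set C)))"
      using gain.extremal_rank_imp_odd_cycles[OF conn(1,2) S(1,3)] rank_iff by blast
    interpret maximal_disjoint_odd_cycles ?V ?R \<C> by (rule \<C>(1))
    interpret gain_cycles ?V ?R \<C> \<phi> by unfold_locales
    have iii: ?iii
      using \<C>(2) contraction_of_maximal_cycles[OF maximal_disjoint_cycles_axioms]
      by (simp add: matching_number_eq arcs_ends_induce)
    have "set us \<inter> set ws = {}"
      if us: "rel_cycle ?R us" and ws: "rel_cycle ?R ws" and ne: "cyclic_edges us \<noteq> cyclic_edges ws" for us ws
    proof -
      obtain C where C: "C \<in> \<C>" "set us = set C" "cyclic_edges us = cyclic_edges C"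
        by (rule cycle_same_vertices[OF us])
      obtain D where D: "D \<in> \<C>" "set ws = set D" "cyclic_edges ws = cyclic_edges D"
        by (rule cycle_same_vertices[OF ws])
      show ?thesis using C D ne cycles_disjointD by blast
    qed
    then have ?i unfolding i_iff by blast
    moreover have "odd (length us)" if "rel_cycle ?R us" for us
      using cycle_is_chordless[OF that] chordless_gain_cycle.odd_length by blast
    then have ?ii
      using equivalence[OF \<C>(1) iii] \<open>?rank\<close> unfolding cycles by simp
    ultimately show "?i \<and> ?ii \<and> ?iii" using iii by blast
  next
    assume rhs: "?i \<and> ?ii \<and> ?iii"
    have "\<exists>\<C>. maximal_disjoint_cycles ?V ?R \<C>"
      using rhs unfolding i_iff by (intro gain.disjoint_cycles_imp_maximal_family[OF conn(1,2)]) blast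
    then obtain \<C> where \<C>: "maximal_disjoint_cycles ?V ?R \<C>" by blast
    interpret maximal_disjoint_cycles ?V ?R \<C> by (rule \<C>)
    have "odd (length C)" if "C \<in> \<C>" for C
      using rhs cycle_in[OF that] unfolding cycles by simp
    then have "maximal_disjoint_odd_cycles ?V ?R \<C>" by unfold_locales
    from equivalence[OF this] rhs show ?rank unfolding cycles by blast
  qed
qed

end
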